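(* Let $n\ge 2$, $0<s<1$, $0<q\le1$, and let $\varphi:\mathbb{R}^n\to\mathbb{R}^n$ be a homeomorphism such that the mapping $f\mapsto f\circ\varphi$ is uniformly bounded from $\dot{B}^s_{n/s,q}(\Omega)$ into $\dot{B}^s_{n/s,q}(\varphi^{-1}(\Omega))$ for all bounded domains $\Omega\subset\mathbb{R}^n$. Then $\varphi$ is bi-Lipschitz.
   Context: For a domain $\Omega\subset\mathbb{R}^n$, $0<s<1$, $p=n/s$ and $0<q<\infty$, a Haj\l asz $s$-gradient of a function $f$ on $\Omega$ is a sequence $(g_k)_{k\in\mathbb{Z}}$ of measurable functions $g_k:\Omega\to[0,\infty]$ such that for all $k\in\mathbb{Z}$, $$|f(x)-f(y)|\le|x-y|^s\big(g_k(x)+g_k(y)\big)$$ for all $x,y\in\Omega$ with $2^{-k-1}\le|x-y|<2^{-k}$. The space $\dot{B}^s_{p,q}(\Omega)$ consists of the measurable functions $f$ on $\Omega$ (modulo constants) with $$\|f\|_{\dot{B}^s_{p,q}(\Omega)}=\inf\left(\sum_{k\in\mathbb{Z}}\|g_k\|_{L^p(\Omega)}^q\right)^{1/q}<\infty,$$ the infimum being over all Haj\l asz $s$-gradients of $f$. "Uniformly bounded" means: there is a constant $C$, independent of $\Omega$, such that $\|f\circ\varphi\|_{\dot{B}^s_{p,q}(\varphi^{-1}(\Omega))}\le C\|f\|_{\dot{B}^s_{p,q}(\Omega)}$ for every bounded domain $\Omega\subset\mathbb{R}^n$ and every continuous $f\in\dot{B}^s_{p,q}(\Omega)$. $\varphi$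 is bi-Lipschitz if there is $L\ge 1$ with $L^{-1}|x-y|\le|\varphi(x)-\varphi(y)|\le L|x-y|$ for all $x,y$. *)

theory Defs
  imports "HOL-Analysis.Analysis"
begin

text \<open>Real power on \<open>[0, \<infinity>]\<close>, intended for positive exponents only
  (so that \<open>0\<close> and \<open>\<infinity>\<close> are fixed).\<close>

definition ennreal_powr :: "ennreal \<Rightarrow> real \<Rightarrow> ennreal" where
  "ennreal_powr x a = (if x = \<infinity> then \<infinity> else ennreal (enn2real x powr a))"

definition Lp_norm :: "real \<Rightarrow> 'a::euclidean_space set \<Rightarrow> ('a \<Rightarrow> ennreal) \<Rightarrow> ennreal" where
  "Lp_norm p \<Omega> g = ennreal_powr (\<integral>\<^sup>+x. ennreal_powr (g x) p \<partial>lebesgue_on \<Omega>) (1 / p)"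

text \<open>Functions on \<open>\<Omega>\<close> are represented by total functions; only the values on \<open>\<Omega>\<close> matter
  in all of the following definitions.\<close>

definition hajlasz_gradient ::
    "real \<Rightarrow> 'a::euclidean_space set \<Rightarrow> ('a \<Rightarrow> real) \<Rightarrow> (int \<Rightarrow> 'a \<Rightarrow> ennreal) \<Rightarrow> bool" where
  "hajlasz_gradient s \<Omega> f g \<longleftrightarrow>
     (\<forall>k. g k \<in> borel_measurable (lebesgue_on \<Omega>)) \<and>
     (\<forall>k. \<forall>x\<in>\<Omega>. \<forall>y\<in>\<Omega>. 2 powi (- k - 1) \<le> norm (x - y) \<and> norm (x - y) < 2 powi (- k) \<longrightarrow>
        ennreal \<bar>f x - f y\<bar> \<le> ennreal (norm (x - y) powr s) * (g k x + g k y))"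

definition besov_norm ::
    "real \<Rightarrow> real \<Rightarrow> real \<Rightarrow> 'a::euclidean_space set \<Rightarrow> ('a \<Rightarrow> real) \<Rightarrow> ennreal" where
  "besov_norm s p q \<Omega> f =
     (INF g\<in>{g. hajlasz_gradient s \<Omega> f g}.
        ennreal_powr (\<Sum>\<^sub>\<infinity>k::int. ennreal_powr (Lp_norm p \<Omega> (g k)) q) (1 / q))"

text \<open>The quotient by constants is not formed: \<open>besov_norm\<close> is invariant under adding constants,
  so the space is given by its representatives.\<close>

definition besov_space ::
    "real \<Rightarrow> real \<Rightarrow> real \<Rightarrow> 'a::euclidean_space set \<Rightarrow> ('a \<Rightarrow> real) set" where
  "besov_space s p q \<Omega> =
     {f. f \<in> borel_measurable (lebesgue_on \<Omega>) \<and> besov_norm s p q \<Omega> f < \<infinity>}"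

definition bounded_domain :: "'a::euclidean_space set \<Rightarrow> bool" where
  "bounded_domain \<Omega> \<longleftrightarrow> open \<Omega> \<and> connected \<Omega> \<and> \<Omega> \<noteq> {} \<and> bounded \<Omega>"

text \<open>The constant \<open>C\<close> may depend on \<open>s\<close>, \<open>p\<close>, \<open>q\<close> and \<open>\<phi>\<close>, but not on \<open>\<Omega>\<close> or \<open>f\<close>.\<close>

definition composition_uniformly_bounded ::
    "real \<Rightarrow> real \<Rightarrow> real \<Rightarrow> ('a::euclidean_space \<Rightarrow> 'a) \<Rightarrow> bool" where
  "composition_uniformly_bounded s p q \<phi> \<longleftrightarrow>
     (\<exists>C::real. C \<ge> 0 \<and>
        (\<forall>\<Omega> f. bounded_domain \<Omega> \<and> continuous_on \<Omega> f \<and> f \<in> besov_space s p q \<Omega> \<longrightarrow>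
           besov_norm s p q (\<phi> -` \<Omega>) (f \<circ> \<phi>) \<le> ennreal C * besov_norm s p q \<Omega> f))"

definition bi_lipschitz :: "('a::metric_space \<Rightarrow> 'b::metric_space) \<Rightarrow> bool" where
  "bi_lipschitz \<phi> \<longleftrightarrow>
     (\<exists>L::real. L \<ge> 1 \<and>
        (\<forall>x y. inverse L * dist x y \<le> dist (\<phi> x) (\<phi> y) \<and> dist (\<phi> x) (\<phi> y) \<le> L * dist x y))"

end

theory Submission
  imports Defs
begin

text \<open>
  Let \<open>\<psi> = \<phi>\<inverse>\<close>, \<open>p = n/s\<close>. Both function norms are scale invariant because \<open>s p = n\<close>. Suppose \<open>\<psi>\<close>
  maps pairs of points at the common distance \<open>r\<close> to pairs at wildly different distances. By
  connectedness (\<open>n \<ge> 2\<close>) there are \<open>N\<close> pairs at distance \<open>r\<close> whose images lie at distances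
  \<open>d\<^sub>1, \<dots>, d\<^sub>N\<close> separated by a large factor. A function that oscillates at scale \<open>r\<close> near these
  pairs has norm at most a constant times \<open>N\<close> to the power \<open>1/p\<close>. Its composition with \<open>\<phi>\<close>
  oscillates by a fixed amount at each of the \<open>N\<close> scales \<open>d\<^sub>i\<close>, and each scale contributes a
  fixed amount to the sum defining the \<open>q\<close>-th power of the norm, so this norm is at least a
  constant times \<open>N\<close> to the power \<open>1/q\<close>. As \<open>q \<le> 1 < p\<close>, this is impossible for large \<open>N\<close>.
  Hence \<open>\<psi>\<close> distorts all pairs at equal distance by comparable amounts, and chaining along
  segments in the domain and in the range makes \<open>\<psi>\<close> bi-Lipschitz.

  A single scale is isolated by choosing the two points on a sphere of generic
  radius: the mass of the gradient near that sphere then decays geometrically in the scale, so that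
  only boundedly many scales below \<open>d\<^sub>i\<close> matter.
\<close>

section \<open>Chaining along segments: from comparable distortion to the bi-Lipschitz
  property\<close>

lemma connected_attains_value:
  fixes g :: "'a::topological_space \<Rightarrow> real"
  assumes "connected S" "continuous_on S g" "a \<in> S" "b \<in> S" "g a \<le> v" "v \<le> g b"
  obtains c where "c \<in> S" "g c = v"
proof -
  have "connected (g ` S)" using assms connected_continuous_image by blast
  then have "{g a..g b} \<subseteq> g ` S" using assms connected_contains_Icc by blast
  then have "v \<in> g ` S" using assms by auto
  then show thesis using that by blast
qed

text \<open>The chain follows the segment from \<open>\<psi> x\<close> to \<open>\<psi> y\<close>,
  not the one from \<open>x\<close> to \<open>y\<close>: distances add up exactly along it, so lower
  bounds for single steps can be summed. Each step ends at a point whose image under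
  \<open>\<phi>\<close> is at distance \<open>r\<close> from the current point, which uses up at
  most \<open>r\<close> of the distance left to \<open>y\<close>.\<close>

lemma chain_lower_bound:
  fixes \<phi> \<psi> :: "'a::euclidean_space \<Rightarrow> 'a"
  assumes cont: "continuous_on UNIV \<phi>" and inv: "\<And>x. \<phi> (\<psi> x) = x"
    and inv': "\<And>x. \<psi> (\<phi> x) = x" and "r > 0"
    and step: "\<And>u v. dist u v = r \<Longrightarrow> \<delta> \<le> dist (\<psi> u) (\<psi> v)"
    and "real M * r \<le> dist x y"
  shows "real M * \<delta> \<le> dist (\<psi> x) (\<psi> y)"
  using \<open>real M * r \<le> dist x y\<close>
proof (induction M arbitrary: x)
  case 0
  then show ?case by simp
next
  case (Suc M)
  have "0 \<le> real M * r" using \<open>r > 0\<close> by simp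
  then have "r \<le> dist x y" using Suc.prems by (simp add: algebra_simps)
  moreover have "continuous_on (closed_segment (\<psi> x) (\<psi> y)) (\<lambda>c. dist x (\<phi> c))"
    by (intro continuous_intros continuous_on_subset[OF cont]) auto
  ultimately obtain c where c: "c \<in> closed_segment (\<psi> x) (\<psi> y)" "dist x (\<phi> c) = r"
    using \<open>r > 0\<close> inv
    by (auto intro: connected_attains_value[of "closed_segment (\<psi> x) (\<psi> y)" "\<lambda>c. dist x (\<phi> c)" "\<psi> x" "\<psi> y" r])
  have "dist x y \<le> r + dist (\<phi> c) y" using c(2) dist_triangle[of x y "\<phi> c"] by simp
  then have "real M * r \<le> dist (\<phi> c) y" using Suc.prems by (simp add: algebra_simps)
  then have "real M * \<delta> \<le> dist c (\<psi> y)" using Suc.IH inv' by metis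
  moreover have "\<delta> \<le> dist (\<psi> x) c" using step c(2) inv' by metis
  moreover have "dist (\<psi> x) (\<psi> y) = dist (\<psi> x) c + dist c (\<psi> y)"
    using c(1) by (metis between between_mem_segment)
  ultimately show ?case by (simp add: algebra_simps)
qed

lemma chain_upper_bound:
  fixes \<psi> :: "'a::euclidean_space \<Rightarrow> 'b::metric_space"
  assumes "norm e = r" and step: "\<And>u v. dist u v = r \<Longrightarrow> dist (\<psi> u) (\<psi> v) \<le> \<Delta>"
  shows "dist (\<psi> x) (\<psi> (x + real M *\<^sub>R e)) \<le> real M * \<Delta>"
proof (induction M)
  case 0
  then show ?case by simp
next
  case (Suc M)
  have "dist (x + real M *\<^sub>R e) (x + real (Suc M) *\<^sub>R e) = r"
    using assms(1) by (simp add: dist_norm algebra_simps)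
  then have "dist (\<psi> (x + real M *\<^sub>R e)) (\<psi> (x + real (Suc M) *\<^sub>R e)) \<le> \<Delta>"
    using step by blast
  with Suc dist_triangle[of "\<psi> x" "\<psi> (x + real (Suc M) *\<^sub>R e)" "\<psi> (x + real M *\<^sub>R e)"]
  show ?case by (simp add: algebra_simps)
qed

text \<open>Only pairs at different distances remain to be compared. Chaining bounds the quotient
  \<open>dist (\<psi> x) (\<psi> y) / dist x y\<close> at one distance by that at any other, and
  comparison with one fixed pair gives the Lipschitz constants.\<close>

lemma bi_lipschitz_if_inverse_round:
  fixes \<phi> \<psi> :: "'a::euclidean_space \<Rightarrow> 'a"
  assumes hom: "homeomorphism UNIV UNIV \<phi> \<psi>"
    and round: "\<And>x y u v. dist x y = dist u v \<Longrightarrow> dist (\<psi> x) (\<psi> y) \<le> K * dist (\<psi> u) (\<psi> v)"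
  shows "bi_lipschitz \<phi>"
proof -
  have cont: "continuous_on UNIV \<phi>" and inv: "\<And>x. \<phi> (\<psi> x) = x" "\<And>x. \<psi> (\<phi> x) = x"
    using hom by (auto simp: homeomorphism_def)
  obtain e :: 'a where "e \<in> Basis" using nonempty_Basis by blast
  then have e: "norm e = 1" by simp
  define D where "D = dist (\<psi> e) (\<psi> 0)"
  have pos: "dist (\<psi> x) (\<psi> y) > 0" if "x \<noteq> y" for x y
    using that inv by (metis zero_less_dist_iff)
  have D: "D > 0" unfolding D_def using e by (intro pos) auto
  have "D \<le> K * D" using round[of e 0 e 0] by (simp add: D_def)
  then have K: "K \<ge> 1" using D by simp
  \<comment> \<open>Small distances against large ones: the floor of \<open>R / r\<close> counts the
    steps of length \<open>r\<close> that fit into \<open>R\<close>. Rounding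
    \<open>R / r \<ge> 1\<close> down loses the factor 2.\<close>
  have cmp: "dist (\<psi> u) (\<psi> v) / dist u v \<le> 2 * K * (dist (\<psi> x) (\<psi> y) / dist x y)"
    if uv: "0 < dist u v" "dist u v \<le> dist x y" for u v x y
  proof -
    define r R M where "r = dist u v" and "R = dist x y" and "M = nat \<lfloor>R / r\<rfloor>"
    have rR: "0 < r" "r \<le> R" "1 \<le> R / r" using uv by (auto simp: r_def R_def)
    have M: "real M = of_int \<lfloor>R / r\<rfloor>" "1 \<le> \<lfloor>R / r\<rfloor>" using rR by (auto simp: M_def)
    have "real M \<le> R / r" using M by linarith
    then have Mr: "real M * r \<le> dist x y" using rR by (simp add: field_simps R_def)
    have "R / r \<le> 2 * real M" using M by linarith
    then have MR: "R \<le> 2 * real M * r" using rR by (simp add: field_simps)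
    have "real M * (dist (\<psi> u) (\<psi> v) / K) \<le> dist (\<psi> x) (\<psi> y)"
    proof (rule chain_lower_bound[OF cont _ _ rR(1) _ Mr])
 fix u' v' :: 'a assume "dist u' v' = r"
      then show "dist (\<psi> u) (\<psi> v) / K \<le> dist (\<psi> u') (\<psi> v')"
        using round[of u v u' v'] K by (simp add: r_def field_simps)
    qed (use inv in auto)
    then have "real M * dist (\<psi> u) (\<psi> v) \<le> K * dist (\<psi> x) (\<psi> y)"
      using K by (simp add: field_simps)
    then have "2 * r * (real M * dist (\<psi> u) (\<psi> v)) \<le> 2 * r * (K * dist (\<psi> x) (\<psi> y))"
      using rR by (intro mult_left_mono) auto
    moreover have "R * dist (\<psi> u) (\<psi> v) \<le> (2 * real M * r) * dist (\<psi> u) (\<psi> v)"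
      using MR by (intro mult_right_mono) auto
    ultimately have "R * dist (\<psi> u) (\<psi> v) \<le> 2 * r * (K * dist (\<psi> x) (\<psi> y))"
      by (simp add: algebra_simps)
    then show ?thesis using rR by (simp add: r_def[symmetric] R_def[symmetric] field_simps)
  qed
  \<comment> \<open>Large distances against small ones: \<open>M\<close> equal steps of length
    \<open>r\<close> cover the distance \<open>M * r \<ge> R\<close>, and \<open>cmp\<close>
    compares that distance with \<open>R\<close>. One factor \<open>K\<close> comes from
    \<open>cmp\<close>, the other from \<open>round\<close>.\<close>
  have cmp': "dist (\<psi> x) (\<psi> y) / dist x y \<le> 2 * K\<^sup>2 * (dist (\<psi> u) (\<psi> v) / dist u v)"
    if uv: "0 < dist u v" "dist u v \<le> dist x y" for u v x y
  proof -
    define r R M where "r = dist u v" and "R = dist x y" and "M = nat \<lceil>R / r\<rceil>"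
    have rR: "0 < r" "r \<le> R" "1 \<le> R / r" using uv by (auto simp: r_def R_def)
    have M: "real M = of_int \<lceil>R / r\<rceil>" using rR by (auto simp: M_def)
    have "R / r \<le> real M" using M by linarith
    then have Mr: "R \<le> real M * r" "0 < real M"
      using rR by (simp add: field_simps, use \<open>R / r \<le> real M\<close> rR in linarith)
    have "dist (\<psi> 0) (\<psi> (0 + real M *\<^sub>R (r *\<^sub>R e))) \<le> real M * (K * dist (\<psi> u) (\<psi> v))"
      by (rule chain_upper_bound) (use e rR round r_def in auto)
    moreover have "dist (\<psi> x) (\<psi> y) / dist x y \<le>
        2 * K * (dist (\<psi> 0) (\<psi> (0 + real M *\<^sub>R (r *\<^sub>R e))) / dist 0 (0 + real M *\<^sub>R (r *\<^sub>R e)))"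
      using e rR Mr by (intro cmp) (auto simp: R_def)
    moreover have "dist 0 (0 + real M *\<^sub>R (r *\<^sub>R e)) = real M * r" using e rR by simp
    ultimately have "dist (\<psi> x) (\<psi> y) / dist x y \<le> 2 * K * (real M * (K * dist (\<psi> u) (\<psi> v)) / (real M * r))"
      using K rR Mr by (smt (verit, best) divide_right_mono mult_left_mono mult_nonneg_nonneg)
    also have "\<dots> = 2 * K\<^sup>2 * (dist (\<psi> u) (\<psi> v) / r)" using Mr by (simp add: power2_eq_square)
    finally show ?thesis by (simp add: r_def)
  qed
  have quot: "dist (\<psi> x) (\<psi> y) / dist x y \<le> 2 * K\<^sup>2 * (dist (\<psi> u) (\<psi> v) / dist u v)"
    if "x \<noteq> y" "u \<noteq> v" for x y u v
  proof (cases "dist u v \<le> dist x y")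
    case True
    then show ?thesis using cmp' that by simp
  next
    case False
    then have "dist (\<psi> x) (\<psi> y) / dist x y \<le> 2 * K * (dist (\<psi> u) (\<psi> v) / dist u v)"
      using cmp that by simp
    also have "\<dots> \<le> 2 * K\<^sup>2 * (dist (\<psi> u) (\<psi> v) / dist u v)"
      using K by (intro mult_right_mono) (auto simp: power2_eq_square)
    finally show ?thesis .
  qed
  \<comment> \<open>The pair \<open>e\<close>, \<open>0\<close> has distance 1 and quotient
    \<open>D\<close>; using it in \<open>quot\<close> once as the second pair and once as the first
    yields the two bounds.\<close>
  define L where "L = max 1 (max (2 * K\<^sup>2 * D) (2 * K\<^sup>2 / D))"
  have "inverse L * dist a b \<le> dist (\<phi> a) (\<phi> b) \<and> dist (\<phi> a) (\<phi> b) \<le> L * dist a b" for a b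
  proof (cases "a = b")
    case False
    then have ne: "\<phi> a \<noteq> \<phi> b" "e \<noteq> 0" using inv e by (metis, auto)
    have "dist a b / dist (\<phi> a) (\<phi> b) \<le> 2 * K\<^sup>2 * D"
      using quot[OF ne] e by (simp add: inv D_def)
    also have "\<dots> \<le> L" by (simp add: L_def)
    finally have 1: "dist a b \<le> L * dist (\<phi> a) (\<phi> b)" using ne by (simp add: field_simps)
    have "D \<le> 2 * K\<^sup>2 * (dist a b / dist (\<phi> a) (\<phi> b))"
      using quot[OF ne(2,1)] e by (simp add: inv D_def)
    then have "dist (\<phi> a) (\<phi> b) \<le> (2 * K\<^sup>2 / D) * dist a b" using ne D by (simp add: field_simps)
    also have "\<dots> \<le> L * dist a b" by (intro mult_right_mono) (auto simp: L_def)
    finally show ?thesis using 1 by (simp add: L_def field_simps)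
  qed auto
  moreover have "L \<ge> 1" by (simp add: L_def)
  ultimately show ?thesis unfolding bi_lipschitz_def by blast
qed

section \<open>Images of spheres under a homeomorphism\<close>

text \<open>A point of the compact image farthest from \<open>w\<close> cannot come from the open
  ball, whose image is open and would contain points still farther out. So the maximal distance is
  attained on the image of the sphere.\<close>

lemma compact_image_subset_ball:
  fixes f :: "'a::euclidean_space \<Rightarrow> 'b::euclidean_space"
  assumes cont: "continuous_on UNIV f" and op: "open (f ` ball z \<tau>)" and "\<tau> > 0"
    and bd: "f ` sphere z \<tau> \<subseteq> ball w \<rho>"
  shows "f ` cball z \<tau> \<subseteq> ball w \<rho>"
proof -
  let ?K = "f ` cball z \<tau>"
  have "compact ?K" "?K \<noteq> {}"
    using continuous_on_subset[OF cont] \<open>\<tau> > 0\<close> by (auto intro!: compact_continuous_image)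
  then obtain k where k: "k \<in> ?K" "\<And>y. y \<in> ?K \<Longrightarrow> dist w y \<le> dist w k"
    using distance_attains_sup by metis
  have "k \<notin> f ` ball z \<tau>"
  proof
    assume "k \<in> f ` ball z \<tau>"
    then obtain e where e: "e > 0" "cball k e \<subseteq> f ` ball z \<tau>"
      using op open_contains_cball by metis
    obtain b :: 'b where b: "b \<in> Basis" using nonempty_Basis by blast
    \<comment> \<open>The outward radial direction at \<open>k\<close>; if \<open>k = w\<close>,
      every direction leads away from \<open>w\<close>.\<close>
    define v where "v = (if k = w then b else (k - w) /\<^sub>R norm (k - w))"
    have nv: "norm v = 1" using b by (auto simp: v_def)
    have eq: "k - w = norm (k - w) *\<^sub>R v" by (simp add: v_def)
    have "k + e *\<^sub>R v \<in> cball k e" using e nv by (simp add: dist_norm)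
    then have "k + e *\<^sub>R v \<in> f ` ball z \<tau>" using e by blast
    then have "k + e *\<^sub>R v \<in> ?K" by (meson ball_subset_cball image_mono subsetD)
    then have "dist w (k + e *\<^sub>R v) \<le> dist w k" using k by blast
    moreover have "k + e *\<^sub>R v - w = (norm (k - w) + e) *\<^sub>R v"
      using eq by (simp add: algebra_simps)
    then have "dist w (k + e *\<^sub>R v) = norm (k - w) + e"
      using e nv by (subst dist_commute) (simp add: dist_norm)
    ultimately show False using e by (simp add: dist_norm norm_minus_commute)
  qed
  then have "k \<in> f ` sphere z \<tau>" using k(1) by (force simp: less_le)
  then have "dist w k < \<rho>" using bd by auto
  then show ?thesis using k by fastforce
qed

text \<open>The centre \<open>Z\<close> is \<open>\<psi> x\<close>, unless some sphere around \<open>\<psi> x\<close> has a small image; then \<open>\<phi>\<close> is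
  nearly constant on the ball it bounds, and the midpoint of \<open>\<psi> x\<close> and \<open>\<psi> y\<close> works for all radii.\<close>

lemma oscillation_on_spheres:
  fixes \<phi> \<psi> :: "'a::euclidean_space \<Rightarrow> 'a"
  assumes dim: "DIM('a) \<ge> 2" and hom: "homeomorphism UNIV UNIV \<phi> \<psi>"
    and "x \<noteq> y"
  defines "r \<equiv> dist x y" and "d \<equiv> dist (\<psi> x) (\<psi> y)"
  obtains Z where "dist Z (\<psi> x) \<le> d"
    "\<And>\<tau>. d/2 < \<tau> \<Longrightarrow> \<tau> < d \<Longrightarrow> \<exists>A\<in>sphere Z \<tau>. \<exists>B\<in>sphere Z \<tau>. dist (\<phi> A) (\<phi> B) = r/20 \<and> \<phi> A \<in> cball x r"
proof -
  have cont: "continuous_on UNIV \<phi>" "continuous_on UNIV \<psi>" and inv: "\<And>x. \<phi> (\<psi> x) = x" "\<And>x. \<psi> (\<phi> x) = x"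
    using hom by (auto simp: homeomorphism_def)
  have r: "r > 0" using \<open>x \<noteq> y\<close> by (simp add: r_def)
  have d: "d > 0" using \<open>x \<noteq> y\<close> inv unfolding d_def by (metis zero_less_dist_iff)
  have op: "open (\<phi> ` U)" if "open U" for U
    using homeomorphism_imp_open_map[OF hom, of U] that by simp
  \<comment> \<open>A dichotomy for a point \<open>A\<close> of a sphere: either the image of the
    sphere leaves the small ball about \<open>\<phi> A\<close>, and connectedness of the sphere
    (dimension at least 2) yields distance exactly \<open>r/20\<close>, or the whole closed ball is
    mapped into the small ball.\<close>
  have reduce: "(\<exists>B\<in>sphere Z \<tau>. dist (\<phi> A) (\<phi> B) = r/20) \<or> \<phi> ` cball Z \<tau> \<subseteq> ball (\<phi> A) (r/20)"
    if "A \<in> sphere Z \<tau>" "\<tau> > 0" for A Z \<tau>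
  proof (cases "\<phi> ` sphere Z \<tau> \<subseteq> ball (\<phi> A) (r/20)")
    case True
    then show ?thesis using compact_image_subset_ball[OF cont(1) op] that by blast
  next
    case False
    then obtain B where "B \<in> sphere Z \<tau>" "r/20 \<le> dist (\<phi> A) (\<phi> B)"
      by (force simp: image_subset_iff not_less)
    moreover have "connected (sphere Z \<tau>)" using dim by (rule connected_sphere)
    moreover have "continuous_on (sphere Z \<tau>) (\<lambda>c. dist (\<phi> A) (\<phi> c))"
      by (intro continuous_intros continuous_on_subset[OF cont(1)]) auto
    ultimately show ?thesis
      using r that(1) connected_attains_value[of "sphere Z \<tau>" "\<lambda>c. dist (\<phi> A) (\<phi> c)" A B "r/20"] by force
  qed
  show thesis
  proof (cases "\<forall>\<tau>. d/2 < \<tau> \<longrightarrow> \<tau> < d \<longrightarrow> (\<exists>A\<in>sphere (\<psi> x) \<tau>. \<exists>B\<in>sphere (\<psi> x) \<tau>. dist (\<phi> A) (\<phi> B) = r/20 \<and> \<phi> A \<in> cball x r)")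
    case True
    then show ?thesis using that[of "\<psi> x"] d by auto
  next
    case False
    then obtain \<tau> where \<tau>: "d/2 < \<tau>" "\<tau> < d"
      and bad: "\<And>A B. A \<in> sphere (\<psi> x) \<tau> \<Longrightarrow> B \<in> sphere (\<psi> x) \<tau> \<Longrightarrow> dist (\<phi> A) (\<phi> B) = r/20 \<Longrightarrow> \<phi> A \<notin> cball x r"
      by blast
    \<comment> \<open>The bad sphere contains \<open>\<psi> c\<close> for some \<open>c\<close> on
      the segment from \<open>x\<close> to \<open>y\<close>. As \<open>c\<close> is within
      \<open>r\<close> of \<open>x\<close>, the first alternative of \<open>reduce\<close> is
      excluded for \<open>\<psi> c\<close>.\<close>
    have "continuous_on (closed_segment x y) (\<lambda>c. dist (\<psi> x) (\<psi> c))"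
      by (intro continuous_intros continuous_on_subset[OF cont(2)]) auto
    then obtain c where c: "c \<in> closed_segment x y" "dist (\<psi> x) (\<psi> c) = \<tau>"
      using \<tau> d by (auto simp: d_def intro: connected_attains_value[of "closed_segment x y" "\<lambda>c. dist (\<psi> x) (\<psi> c)" x y \<tau>])
    have "dist x c \<le> r" using c(1) unfolding r_def dist_norm
      by (metis dist_commute dist_in_closed_segment(1) dist_norm)
    then have cA: "\<phi> (\<psi> c) \<in> cball x r" using inv by simp
    have small: "\<phi> ` cball (\<psi> x) \<tau> \<subseteq> ball c (r/20)"
      using reduce[of "\<psi> c" "\<psi> x" \<tau>] bad c \<tau> d cA inv by fastforce
    define M where "M = midpoint (\<psi> x) (\<psi> y)"
    have xM: "dist M (\<psi> x) = d/2" "dist M (\<psi> y) = d/2" by (auto simp: M_def d_def dist_midpoint)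
    show ?thesis
    proof (rule that[of M])
      show "dist M (\<psi> x) \<le> d" using xM d by simp
      fix \<tau>' assume t: "d/2 < \<tau>'" "\<tau>' < d"
      \<comment> \<open>The point of the sphere on the ray from the midpoint through
        \<open>\<psi> x\<close>. Its distance \<open>\<tau>' - d/2\<close> to
        \<open>\<psi> x\<close> is less than \<open>d/2\<close>, so it lies in the ball with small
        image.\<close>
      define A where "A = M + (2*\<tau>'/d) *\<^sub>R (\<psi> x - M)"
      have "dist A M = \<bar>2*\<tau>'/d\<bar> * dist M (\<psi> x)" by (simp add: A_def dist_norm norm_minus_commute)
      then have "dist M A = \<tau>'" using d t unfolding xM(1) by (simp add: dist_commute)
      have "A - \<psi> x = (2*\<tau>'/d - 1) *\<^sub>R (\<psi> x - M)" by (simp add: A_def algebra_simps)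
      then have "dist A (\<psi> x) = \<bar>2*\<tau>'/d - 1\<bar> * (d/2)" using xM by (simp add: dist_norm norm_minus_commute)
      also have "\<dots> = \<tau>' - d/2" using t d by (simp add: abs_if field_simps)
      finally have "dist (\<psi> x) A \<le> \<tau>" using t \<tau> by (simp add: dist_commute)
      then have "\<phi> A \<in> ball c (r/20)" using small by (meson image_subset_iff mem_cball)
      moreover have "\<phi> (\<psi> x) \<in> ball c (r/20)" using small \<tau> d by (intro subsetD[OF small] imageI) simp
      then have "x \<in> ball c (r/20)" by (simp only: inv)
      ultimately have "dist (\<phi> A) x < r/20 + r/20" by (metis dist_commute dist_triangle_less_add mem_ball)
      then have A: "\<phi> A \<in> cball x r" using r by (simp add: dist_commute)
      \<comment> \<open>Both \<open>\<psi> x\<close> and \<open>\<psi> y\<close> lie in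
        \<open>cball M \<tau>'\<close>, so a small image would put \<open>x\<close> and
        \<open>y\<close> within \<open>r/10\<close> of each other.\<close>
      have "\<not> \<phi> ` cball M \<tau>' \<subseteq> ball (\<phi> A) (r/20)"
      proof
        assume sub: "\<phi> ` cball M \<tau>' \<subseteq> ball (\<phi> A) (r/20)"
        have "\<phi> (\<psi> x) \<in> ball (\<phi> A) (r/20)" "\<phi> (\<psi> y) \<in> ball (\<phi> A) (r/20)"
          by (rule subsetD[OF sub], rule imageI, use xM t in simp)+
        then have "dist x y < r/20 + r/20" unfolding inv by (metis dist_commute dist_triangle_less_add mem_ball)
        then show False using r by (simp add: r_def)
      qed
      then show "\<exists>A\<in>sphere M \<tau>'. \<exists>B\<in>sphere M \<tau>'. dist (\<phi> A) (\<phi> B) = r/20 \<and> \<phi> A \<in> cball x r"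
        using reduce[of A M \<tau>'] \<open>dist M A = \<tau>'\<close> t d A by force
    qed
  qed
qed

section \<open>Masses of annuli and the choice of a radius\<close>

text \<open>The map \<open>dist Z\<close> pushes the density \<open>u\<close> forward to a finite
  measure on the line and turns annuli into intervals. Fubini then applies, and each distance
  \<open>y\<close> is counted for the radii in an interval of length \<open>2 * t\<close> about
  \<open>y\<close>.\<close>

lemma nn_integral_annuli_le:
  fixes u :: "'a::euclidean_space \<Rightarrow> ennreal"
  assumes u[measurable]: "u \<in> borel_measurable lebesgue" and fin: "(\<integral>\<^sup>+x. u x \<partial>lebesgue) \<le> ennreal \<Lambda>"
    and "t \<ge> 0"
  shows "(\<lambda>\<tau>. \<integral>\<^sup>+x. u x * indicator {x. \<bar>dist Z x - \<tau>\<bar> < t} x \<partial>lebesgue) \<in> borel_measurable borel"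
    and "(\<integral>\<^sup>+\<tau>. (\<integral>\<^sup>+x. u x * indicator {x. \<bar>dist Z x - \<tau>\<bar> < t} x \<partial>lebesgue) \<partial>lborel)
      \<le> ennreal (2 * t) * ennreal \<Lambda>"
proof -
  have m[measurable]: "dist Z \<in> borel_measurable lebesgue"
    by (intro measurable_completion) measurable
  define \<mu> where "\<mu> = distr (density lebesgue u) borel (dist Z)"
  have sets[measurable_cong]: "sets \<mu> = sets borel" by (simp add: \<mu>_def)
  have sp: "emeasure \<mu> (space \<mu>) = (\<integral>\<^sup>+x. u x \<partial>lebesgue)"
    by (simp add: \<mu>_def emeasure_distr emeasure_density)
  then have "emeasure \<mu> (space \<mu>) \<noteq> \<infinity>" using fin by (auto simp: top_unique)
  then interpret finite_measure \<mu> by (rule finite_measureI)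
  interpret P: pair_sigma_finite \<mu> lborel ..
  have rep: "(\<integral>\<^sup>+x. u x * indicator {x. \<bar>dist Z x - \<tau>\<bar> < t} x \<partial>lebesgue)
      = (\<integral>\<^sup>+y. indicator {w. \<bar>fst w - snd w\<bar> < t} (y, \<tau>) \<partial>\<mu>)" for \<tau>
    by (simp add: \<mu>_def nn_integral_distr nn_integral_density indicator_def)
  have 0: "(\<lambda>w::real\<times>real. indicator {w. \<bar>fst w - snd w\<bar> < t} w :: ennreal) \<in> borel_measurable (\<mu> \<Otimes>\<^sub>M lborel)"
    by measurable
  show "(\<lambda>\<tau>. \<integral>\<^sup>+x. u x * indicator {x. \<bar>dist Z x - \<tau>\<bar> < t} x \<partial>lebesgue) \<in> borel_measurable borel"
    unfolding rep by measurable
  have "(\<integral>\<^sup>+\<tau>. (\<integral>\<^sup>+y. indicator {w. \<bar>fst w - snd w\<bar> < t} (y, \<tau>) \<partial>\<mu>) \<partial>lborel)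
      = (\<integral>\<^sup>+y. (\<integral>\<^sup>+\<tau>. indicator {w. \<bar>fst w - snd w\<bar> < t} (y, \<tau>) \<partial>lborel) \<partial>\<mu>)"
    using P.Fubini[OF 0] by simp
  also have "\<dots> = (\<integral>\<^sup>+y. ennreal (2 * t) \<partial>\<mu>)"
  proof (rule nn_integral_cong)
    fix y
    have "(\<integral>\<^sup>+\<tau>. indicator {w. \<bar>fst w - snd w\<bar> < t} (y, \<tau>) \<partial>lborel)
        = (\<integral>\<^sup>+\<tau>. indicator {y - t<..<y + t} \<tau> \<partial>lborel)"
      by (intro nn_integral_cong) (auto simp: indicator_def abs_less_iff)
    also have "\<dots> = ennreal (2 * t)" using \<open>t \<ge> 0\<close> by simp
    finally show "(\<integral>\<^sup>+\<tau>. indicator {w. \<bar>fst w - snd w\<bar> < t} (y, \<tau>) \<partial>lborel) = ennreal (2 * t)" .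
  qed
  also have "\<dots> \<le> ennreal (2 * t) * ennreal \<Lambda>" using sp fin by (simp add: mult_left_mono)
  finally show "(\<integral>\<^sup>+\<tau>. (\<integral>\<^sup>+x. u x * indicator {x. \<bar>dist Z x - \<tau>\<bar> < t} x \<partial>lebesgue) \<partial>lborel)
      \<le> ennreal (2 * t) * ennreal \<Lambda>" unfolding rep .
qed

text \<open>Markov's inequality in the radius, applied to the annular masses weighted by \<open>(4/3)\<^sup>i\<close>.\<close>

lemma radius_selection:
  fixes u :: "nat \<Rightarrow> 'a::euclidean_space \<Rightarrow> ennreal"
  assumes u: "\<And>i. u i \<in> borel_measurable lebesgue"
    and fin: "\<And>i. (\<integral>\<^sup>+x. u i x \<partial>lebesgue) \<le> ennreal \<Lambda>"
    and "\<Lambda> > 0" "d > 0" "t0 \<ge> 0" "t0 \<le> 64 * d"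
  obtains \<tau> where "d/2 < \<tau>" "\<tau> < d"
    "\<And>i. (\<integral>\<^sup>+x. u i x * indicator {x. \<bar>dist Z x - \<tau>\<bar> < 4 * (t0 / 2^i)} x \<partial>lebesgue)
      \<le> ennreal (4096 * \<Lambda> * (3/4)^i)"
proof -
  define W where "W i \<tau> = (\<integral>\<^sup>+x. u i x * indicator {x. \<bar>dist Z x - \<tau>\<bar> < 4 * (t0 / 2^i)} x \<partial>lebesgue)" for i \<tau>
  have [measurable]: "W i \<in> borel_measurable borel" for i
    unfolding W_def using \<open>t0 \<ge> 0\<close> by (intro nn_integral_annuli_le[OF u fin]) simp
  have W: "(\<integral>\<^sup>+\<tau>. W i \<tau> \<partial>lborel) \<le> ennreal (2 * (4 * (t0 / 2^i))) * ennreal \<Lambda>" for i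
    unfolding W_def using \<open>t0 \<ge> 0\<close> by (intro nn_integral_annuli_le[OF u fin]) simp
  define V where "V \<tau> = (\<Sum>i. ennreal ((4/3)^i) * W i \<tau>)" for \<tau>
  have [measurable]: "V \<in> borel_measurable borel" unfolding V_def by measurable
  have "(\<integral>\<^sup>+\<tau>. V \<tau> \<partial>lborel) = (\<Sum>i. ennreal ((4/3)^i) * (\<integral>\<^sup>+\<tau>. W i \<tau> \<partial>lborel))"
    unfolding V_def by (subst nn_integral_suminf) (simp_all add: nn_integral_cmult)
  also have "\<dots> \<le> (\<Sum>i. ennreal (8 * t0 * \<Lambda> * (2/3)^i))"
  proof (intro suminf_le)
    fix i
    have "ennreal ((4/3)^i) * (\<integral>\<^sup>+\<tau>. W i \<tau> \<partial>lborel)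
        \<le> ennreal ((4/3)^i) * (ennreal (2 * (4 * (t0 / 2^i))) * ennreal \<Lambda>)"
      by (intro mult_left_mono W) simp
    also have "\<dots> = ennreal ((4/3)^i * ((2 * (4 * (t0 / 2^i))) * \<Lambda>))"
      using \<open>t0 \<ge> 0\<close> \<open>\<Lambda> > 0\<close> by (simp add: ennreal_mult[symmetric] mult.assoc)
    also have "(4/3)^i * ((2 * (4 * (t0 / 2^i))) * \<Lambda>) = 8 * t0 * \<Lambda> * (2/3)^i"
    proof -
      have "(4/3::real)^i / 2^i = (2/3)^i" by (simp add: power_divide[symmetric])
      then show ?thesis by (simp add: field_simps)
    qed
    finally show "ennreal ((4/3)^i) * (\<integral>\<^sup>+\<tau>. W i \<tau> \<partial>lborel) \<le> ennreal (8 * t0 * \<Lambda> * (2/3)^i)" .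
  qed auto
  also have "\<dots> = ennreal (\<Sum>i. 8 * t0 * \<Lambda> * (2/3)^i)"
    using \<open>t0 \<ge> 0\<close> \<open>\<Lambda> > 0\<close> by (intro suminf_ennreal2) (auto intro!: summable_mult summable_geometric)
  also have "(\<Sum>i. 8 * t0 * \<Lambda> * (2/3::real)^i) = 24 * t0 * \<Lambda>"
    by (subst suminf_mult) (auto simp: suminf_geometric)
  finally have V: "(\<integral>\<^sup>+\<tau>. V \<tau> \<partial>lborel) \<le> ennreal (24 * t0 * \<Lambda>)" .
  have "\<exists>\<tau>. d/2 < \<tau> \<and> \<tau> < d \<and> V \<tau> \<le> ennreal (4096 * \<Lambda>)"
  proof (rule ccontr)
    assume neg: "\<not> ?thesis"
    \<comment> \<open>If every radius in this interval of length \<open>d/2\<close> failed, the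
      integral of \<open>V\<close> would be at least \<open>2048 * d * \<Lambda>\<close>, while the
      bound \<open>V\<close> allows at most \<open>24 * 64 * d * \<Lambda>\<close>.\<close>
    have "ennreal (4096 * \<Lambda> * (d/2)) = (\<integral>\<^sup>+\<tau>. ennreal (4096 * \<Lambda>) * indicator {d/2<..<d} \<tau> \<partial>lborel)"
      using \<open>d > 0\<close> \<open>\<Lambda> > 0\<close> by (subst nn_integral_cmult_indicator) (auto simp: ennreal_mult[symmetric] simp del: ennreal_mult' ennreal_mult'')
    also have "\<dots> \<le> (\<integral>\<^sup>+\<tau>. V \<tau> \<partial>lborel)"
      using neg by (intro nn_integral_mono) (auto simp: indicator_def not_le intro: less_imp_le)
    also note V
    finally have "4096 * \<Lambda> * (d/2) \<le> 24 * t0 * \<Lambda>" using \<open>\<Lambda> > 0\<close> \<open>t0 \<ge> 0\<close> by (subst (asm) ennreal_le_iff) auto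
    then have "2048 * d \<le> 24 * t0" using \<open>\<Lambda> > 0\<close> by simp
    then show False using assms by simp
  qed
  then obtain \<tau> where \<tau>: "d/2 < \<tau>" "\<tau> < d" "V \<tau> \<le> ennreal (4096 * \<Lambda>)" by blast
  show thesis
  proof (rule that[OF \<tau>(1,2)])
    fix i
    have "ennreal ((4/3)^i) * W i \<tau> \<le> V \<tau>"
      unfolding V_def using sum_le_suminf[of "\<lambda>i. ennreal ((4/3)^i) * W i \<tau>" "{i}"] by simp
    also note \<tau>(3)
    finally have "ennreal ((3/4)^i) * (ennreal ((4/3)^i) * W i \<tau>) \<le> ennreal ((3/4)^i) * ennreal (4096 * \<Lambda>)"
      by (intro mult_left_mono) auto
    moreover have "ennreal ((3/4)^i) * ennreal ((4/3)^i) = 1"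
      by (simp add: ennreal_mult[symmetric] power_mult_distrib[symmetric])
    ultimately show "(\<integral>\<^sup>+x. u i x * indicator {x. \<bar>dist Z x - \<tau>\<bar> < 4 * (t0 / 2^i)} x \<partial>lebesgue)
      \<le> ennreal (4096 * \<Lambda> * (3/4)^i)"
      using \<open>\<Lambda> > 0\<close> by (simp add: W_def mult.assoc[symmetric]) (simp add: ennreal_mult[symmetric] mult.commute)
  qed
qed

section \<open>Bounding the oscillation on a sphere by telescoping\<close>

text \<open>Markov's inequality for two functions at once: if one of the bounds failed at each
  point, the two functions, normalised by \<open>\<alpha> / V\<close> and
  \<open>\<beta> / V\<close>, would add up to at least 3 on the whole ball, but the integral of this
  sum is at most \<open>2 * V\<close>.\<close>

lemma exists_point_below_averages:
  fixes u w :: "'a::euclidean_space \<Rightarrow> ennreal"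
  assumes [measurable]: "u \<in> borel_measurable lebesgue" "w \<in> borel_measurable lebesgue"
    and u: "(\<integral>\<^sup>+x. u x * indicator (ball c \<rho>) x \<partial>lebesgue) \<le> ennreal \<alpha>"
    and w: "(\<integral>\<^sup>+x. w x * indicator (ball c \<rho>) x \<partial>lebesgue) \<le> ennreal \<beta>"
    and pos: "\<alpha> > 0" "\<beta> > 0" "\<rho> > 0"
  shows "\<exists>z\<in>ball c \<rho>. u z \<le> ennreal (3 * \<alpha> / measure lborel (ball c \<rho>)) \<and>
    w z \<le> ennreal (3 * \<beta> / measure lborel (ball c \<rho>))"
proof (rule ccontr)
  let ?b = "ball c \<rho>"
  define V where "V = measure lborel ?b"
  have V: "V > 0" using pos content_ball_pos by (auto simp: V_def)
  have eV: "emeasure lebesgue ?b = ennreal V"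
    using emeasure_ball[of \<rho> c] content_ball[of \<rho> c] pos by (simp add: V_def)
  have bm[measurable]: "?b \<in> sets lebesgue" by simp
  assume "\<not> ?thesis"
  then have neg: "ennreal (3 * \<alpha> / V) < u z \<or> ennreal (3 * \<beta> / V) < w z" if "z \<in> ?b" for z
    using that by (auto simp: V_def not_le)
  have pt: "3 \<le> ennreal (V / \<alpha>) * u z + ennreal (V / \<beta>) * w z" if "z \<in> ?b" for z
    using neg[OF that]
  proof
    assume "ennreal (3 * \<alpha> / V) < u z"
    then have "ennreal (V / \<alpha>) * ennreal (3 * \<alpha> / V) \<le> ennreal (V / \<alpha>) * u z"
      by (intro mult_left_mono) auto
    moreover have "ennreal (V / \<alpha>) * ennreal (3 * \<alpha> / V) = 3"
      using V pos by (simp add: ennreal_mult[symmetric])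
    ultimately show ?thesis by (simp add: add_increasing2)
  next
    assume "ennreal (3 * \<beta> / V) < w z"
    then have "ennreal (V / \<beta>) * ennreal (3 * \<beta> / V) \<le> ennreal (V / \<beta>) * w z"
      by (intro mult_left_mono) auto
    moreover have "ennreal (V / \<beta>) * ennreal (3 * \<beta> / V) = 3"
      using V pos by (simp add: ennreal_mult[symmetric])
    ultimately show ?thesis by (simp add: add_increasing)
  qed
  have "ennreal (3 * V) = (\<integral>\<^sup>+x. 3 * indicator ?b x \<partial>lebesgue)"
    using V by (subst nn_integral_cmult_indicator) (auto simp: eV ennreal_mult)
  also have "\<dots> \<le> (\<integral>\<^sup>+x. ennreal (V / \<alpha>) * (u x * indicator ?b x) + ennreal (V / \<beta>) * (w x * indicator ?b x) \<partial>lebesgue)"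
    using pt by (intro nn_integral_mono) (auto simp: indicator_def)
  also have "\<dots> = ennreal (V / \<alpha>) * (\<integral>\<^sup>+x. u x * indicator ?b x \<partial>lebesgue)
      + ennreal (V / \<beta>) * (\<integral>\<^sup>+x. w x * indicator ?b x \<partial>lebesgue)"
    by (subst nn_integral_add) (auto simp: nn_integral_cmult)
  also have "\<dots> \<le> ennreal (V / \<alpha>) * ennreal \<alpha> + ennreal (V / \<beta>) * ennreal \<beta>"
    by (intro add_mono mult_left_mono u w) auto
  also have "\<dots> = ennreal (2 * V)"
    using V pos by (simp add: ennreal_mult[symmetric] ennreal_plus[symmetric] del: ennreal_plus)
  finally show False using V by (simp add: ennreal_le_iff)
qed

text \<open>Telescoping along points chosen near \<open>a + t\<^sub>i v\<close> with \<open>t\<^sub>i = t\<^sub>0 / 2\<^sup>i\<close>. The norm \<open>3/2\<close> of \<open>v\<close> puts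
  consecutive points at distance about \<open>3 t\<^sub>i / 4\<close>, inside the dyadic range \<open>[t\<^sub>i / 2, t\<^sub>i)\<close> to which
  the \<open>i\<close>-th gradient applies.\<close>

lemma chain_estimate:
  fixes G :: "'a::euclidean_space \<Rightarrow> real" and u :: "nat \<Rightarrow> 'a \<Rightarrow> ennreal"
  defines "K \<equiv> 3 * 16 ^ DIM('a) / unit_ball_vol (real DIM('a))"
  assumes p: "p > 0" "s * p = real DIM('a)" and t0: "t0 > 0" and v: "norm v = 3/2"
    and u: "\<And>i. u i \<in> borel_measurable lebesgue" and cont: "isCont G a"
    and grad: "\<And>i x y X Y. \<lbrakk>x \<in> ball a (2 * t0); y \<in> ball a (2 * t0);
        t0 / 2^i / 2 \<le> dist x y; dist x y < t0 / 2^i; X \<ge> 0; Y \<ge> 0; u i x \<le> ennreal X; u i y \<le> ennreal Y\<rbrakk>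
      \<Longrightarrow> \<bar>G x - G y\<bar> \<le> (t0 / 2^i) powr s * (X powr (1/p) + Y powr (1/p))"
    and int: "\<And>i. (\<integral>\<^sup>+x. u i x * indicator (ball a (4 * (t0 / 2^i))) x \<partial>lebesgue) \<le> ennreal (\<beta> i powr p)"
    and \<beta>: "\<And>i. \<beta> i > 0" "summable \<beta>"
    and z0: "dist (a + t0 *\<^sub>R v) z0 < t0 / 8" "u 0 z0 \<le> ennreal (K * \<beta> 0 powr p / t0 ^ DIM('a))"
  shows "\<bar>G a - G z0\<bar> \<le> 2 * K powr (1/p) * suminf \<beta>"
proof -
  define \<omega> where "\<omega> = unit_ball_vol (real DIM('a))"
  have \<omega>: "\<omega> > 0" by (simp add: \<omega>_def)
  have K: "K > 0" using \<omega> by (simp add: K_def \<omega>_def)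
  define t where "t i = t0 / 2^i" for i :: nat
  have t: "t i > 0" "t (Suc i) = t i / 2" "t i \<le> t0" "t 0 = t0" for i
    using t0 by (auto simp: t_def divide_le_eq mult_le_cancel_left1)
  define B where "B i = K * \<beta> i powr p / t i ^ DIM('a)" for i
  have B: "B i \<ge> 0" for i using K t by (simp add: B_def less_imp_le)
  \<comment> \<open>The chosen point is compared with both its neighbours in the chain, so it must
    be good for two consecutive gradients.\<close>
  have "\<exists>z. dist (a + t (Suc i) *\<^sub>R v) z < t (Suc i) / 8 \<and> u (Suc i) z \<le> ennreal (B (Suc i)) \<and> u i z \<le> ennreal (B i)" for i
  proof -
    let ?b = "ball (a + t (Suc i) *\<^sub>R v) (t (Suc i) / 8)"
    have sub: "?b \<subseteq> ball a (4 * t (Suc i))" "ball a (4 * t (Suc i)) \<subseteq> ball a (4 * t i)"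
    proof -
      show "?b \<subseteq> ball a (4 * t (Suc i))"
      proof
        fix z assume "z \<in> ?b"
        then have "dist (a + t (Suc i) *\<^sub>R v) z < t (Suc i) / 8" by simp
        moreover have "dist a (a + t (Suc i) *\<^sub>R v) = t (Suc i) * (3/2)"
          using v t(1)[of "Suc i"] by (simp add: dist_norm)
        ultimately have "dist a z < t (Suc i) * (3/2) + t (Suc i) / 8"
          using dist_triangle[of a z "a + t (Suc i) *\<^sub>R v"] by linarith
        then show "z \<in> ball a (4 * t (Suc i))" using t(1)[of "Suc i"] by simp
      qed
      show "ball a (4 * t (Suc i)) \<subseteq> ball a (4 * t i)" using t(1,2)[of i] by (intro subset_ball) simp
    qed
    have mono: "(\<integral>\<^sup>+x. u j x * indicator ?b x \<partial>lebesgue) \<le> ennreal (\<beta> j powr p)" if "j \<in> {i, Suc i}" for j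
    proof -
      have "(\<integral>\<^sup>+x. u j x * indicator ?b x \<partial>lebesgue) \<le> (\<integral>\<^sup>+x. u j x * indicator (ball a (4 * (t0 / 2^j))) x \<partial>lebesgue)"
        using sub that by (intro nn_integral_mono mult_left_mono) (auto simp: indicator_def t_def[symmetric] simp del: mem_ball)
      also note int
      finally show ?thesis .
    qed
    have cb: "measure lborel ?b = \<omega> * (t (Suc i) / 8) ^ DIM('a)" using content_ball[of "t (Suc i) / 8"] t(1)[of "Suc i"] by (simp add: \<omega>_def less_imp_le)
    have "\<exists>z\<in>?b. u (Suc i) z \<le> ennreal (3 * \<beta> (Suc i) powr p / measure lborel ?b) \<and> u i z \<le> ennreal (3 * \<beta> i powr p / measure lborel ?b)"
      using \<beta>(1) t(1)[of "Suc i"] by (intro exists_point_below_averages u mono) (auto simp: less_imp_neq[OF \<beta>(1), symmetric])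
    \<comment> \<open>The radius of \<open>?b\<close> is \<open>t i / 16\<close>, hence the power of
      16 in \<open>K\<close>; relative to \<open>t (Suc i)\<close> a power of 8 is enough.\<close>
    moreover have "3 * \<beta> i powr p / measure lborel ?b = B i"
      unfolding cb using \<omega> t(1)[of i] by (simp add: t(2) B_def K_def \<omega>_def[symmetric] power_divide)
    moreover have "3 * \<beta> (Suc i) powr p / measure lborel ?b \<le> B (Suc i)"
    proof -
      have "3 * \<beta> (Suc i) powr p / measure lborel ?b = 8 ^ DIM('a) * (3 * \<beta> (Suc i) powr p / (\<omega> * t (Suc i) ^ DIM('a)))"
        unfolding cb by (simp add: power_divide)
      also have "\<dots> \<le> 16 ^ DIM('a) * (3 * \<beta> (Suc i) powr p / (\<omega> * t (Suc i) ^ DIM('a)))"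
        using \<omega> t(1)[of "Suc i"] by (intro mult_right_mono power_mono) (auto simp: less_imp_le)
      also have "\<dots> = B (Suc i)" unfolding B_def K_def \<omega>_def[symmetric] by simp
      finally show ?thesis .
    qed
    ultimately show ?thesis by (metis ennreal_leI mem_ball order_trans)
  qed
  then obtain z where z: "\<And>i. dist (a + t (Suc i) *\<^sub>R v) (z i) < t (Suc i) / 8"
    "\<And>i. u (Suc i) (z i) \<le> ennreal (B (Suc i))" "\<And>i. u i (z i) \<le> ennreal (B i)" by metis
  \<comment> \<open>The chain starts at the prescribed \<open>z0\<close>, so that chains with
    different limits \<open>a\<close> can share their starting point.\<close>
  define Z where "Z i = (case i of 0 \<Rightarrow> z0 | Suc j \<Rightarrow> z j)" for i
  have Zd: "dist (a + t i *\<^sub>R v) (Z i) < t i / 8" and Zu: "u i (Z i) \<le> ennreal (B i)" for i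
    by (cases i; use z z0 in \<open>simp add: Z_def B_def t(4)\<close>)+
  have Zu': "u i (Z (Suc i)) \<le> ennreal (B i)" for i using z by (simp add: Z_def)
  have Za: "dist a (Z i) < 2 * t i" for i
  proof -
    have "dist a (a + t i *\<^sub>R v) = t i * (3/2)" using v t(1)[of i] by (simp add: dist_norm)
    then show ?thesis using dist_triangle[of a "Z i" "a + t i *\<^sub>R v"] Zd[of i] t(1)[of i] by linarith
  qed
  have step: "\<bar>G (Z i) - G (Z (Suc i))\<bar> \<le> 2 * K powr (1/p) * \<beta> i" for i
  proof -
    let ?w = "a + t i *\<^sub>R v" and ?w' = "a + t (Suc i) *\<^sub>R v"
    \<comment> \<open>The centres are \<open>3/4 * t i\<close> apart and the points deviate from
      them by less than \<open>t i / 8\<close> and \<open>t i / 16\<close>, so the distance of the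
      points is between 9/16 and 15/16 of \<open>t i\<close>.\<close>
    have "?w - ?w' = (t i / 2) *\<^sub>R v" by (simp add: t scaleR_left_diff_distrib[symmetric])
    then have "dist ?w ?w' = t i * (3/4)" using v t(1)[of i] by (simp add: dist_norm)
    moreover have "dist ?w (Z i) < t i / 8" "dist ?w' (Z (Suc i)) < t i / 16"
      using Zd[of i] Zd[of "Suc i"] by (auto simp: t)
    moreover have "dist ?w ?w' \<le> dist ?w (Z i) + dist (Z i) (Z (Suc i)) + dist ?w' (Z (Suc i))"
      "dist (Z i) (Z (Suc i)) \<le> dist ?w (Z i) + dist ?w ?w' + dist ?w' (Z (Suc i))"
      using dist_triangle[of ?w ?w' "Z i"] dist_triangle[of "Z i" ?w' "Z (Suc i)"]
        dist_triangle[of "Z i" "Z (Suc i)" ?w] dist_triangle[of ?w "Z (Suc i)" ?w']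
      by (auto simp: dist_commute)
    ultimately have d: "t i / 2 \<le> dist (Z i) (Z (Suc i))" "dist (Z i) (Z (Suc i)) < t i"
      using t(1)[of i] by linarith+
    have mem: "Z j \<in> ball a (2 * t0)" for j
      using Za[of j] t(3)[of j] by simp
    have "\<bar>G (Z i) - G (Z (Suc i))\<bar> \<le> (t0 / 2^i) powr s * (B i powr (1/p) + B i powr (1/p))"
      using d by (intro grad mem B Zu Zu') (auto simp: t_def)
    also have "\<dots> = 2 * (t i powr s * B i powr (1/p))" by (simp add: t_def)
    \<comment> \<open>Here \<open>s * p = DIM('a)\<close> makes the scale cancel: the volume factor
      to the power \<open>1/p\<close> is \<open>t i powr s\<close>, which is also the factor in the
      gradient inequality.\<close>
    also have "B i powr (1/p) = K powr (1/p) * \<beta> i / t i powr s"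
    proof -
      have "s = real DIM('a) / p" using p by (simp add: field_simps)
      then have "(t i ^ DIM('a)) powr (1/p) = t i powr s"
        using t(1)[of i] by (simp add: powr_realpow[symmetric] powr_powr)
      moreover have "(\<beta> i powr p) powr (1/p) = \<beta> i" using p \<beta>(1)[of i] by (simp add: powr_powr)
      ultimately show ?thesis using K t(1)[of i] \<beta>(1)[of i]
        by (simp add: B_def powr_divide powr_mult)
    qed
    finally show ?thesis using t(1)[of i] by simp
  qed
  have "\<bar>G z0 - G (Z k)\<bar> \<le> 2 * K powr (1/p) * suminf \<beta>" for k
  proof -
    have "\<bar>G z0 - G (Z k)\<bar> \<le> (\<Sum>i<k. \<bar>G (Z i) - G (Z (Suc i))\<bar>)"
      by (induction k) (auto simp: Z_def)
    also have "\<dots> \<le> (\<Sum>i<k. 2 * K powr (1/p) * \<beta> i)" by (intro sum_mono step)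
    also have "\<dots> = 2 * K powr (1/p) * (\<Sum>i<k. \<beta> i)" by (simp add: sum_distrib_left)
    also have "\<dots> \<le> 2 * K powr (1/p) * suminf \<beta>"
      using \<beta> by (intro mult_left_mono sum_le_suminf) (auto simp: less_imp_le)
    finally show ?thesis .
  qed
  moreover have "(\<lambda>k. \<bar>G z0 - G (Z k)\<bar>) \<longlonglongrightarrow> \<bar>G z0 - G a\<bar>"
  proof -
    have "(\<lambda>k. 2 * (t0 * (1/2)^k)) \<longlonglongrightarrow> 2 * (t0 * 0)" by (intro tendsto_intros LIMSEQ_power_zero) auto
    then have lim: "(\<lambda>k. 2 * t k) \<longlonglongrightarrow> 0" by (simp add: t_def power_one_over)
    have "(\<lambda>k. dist (Z k) a) \<longlonglongrightarrow> 0"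
      by (rule tendsto_sandwich[OF _ _ tendsto_const lim])
        (auto simp: dist_commute intro!: always_eventually less_imp_le Za)
    then have "Z \<longlonglongrightarrow> a" using tendsto_dist_iff by blast
    then show ?thesis using isCont_tendsto_compose[OF cont] by (intro tendsto_intros) auto
  qed
  ultimately have "\<bar>G z0 - G a\<bar> \<le> 2 * K powr (1/p) * suminf \<beta>"
    by (intro LIMSEQ_le_const2) auto
  then show ?thesis by (simp add: abs_minus_commute)
qed

text \<open>Both points are joined by chains to one common point \<open>z0\<close>, which doubles
  the constant of \<open>chain_estimate\<close>. Balls about any point of the sphere lie in the
  annuli around it, so the annular bounds serve \<open>A\<close> and \<open>B\<close> wherever they
  are.\<close>

lemma oscillation_on_sphere_le:
  fixes G :: "'a::euclidean_space \<Rightarrow> real" and u :: "nat \<Rightarrow> 'a \<Rightarrow> ennreal"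
  defines "K \<equiv> 3 * 16 ^ DIM('a) / unit_ball_vol (real DIM('a))"
  assumes p: "p > 0" "s * p = real DIM('a)" and \<tau>: "0 < \<tau>" "\<tau> \<le> t0 / 32"
    and u: "\<And>i. u i \<in> borel_measurable lebesgue" and cont: "continuous_on (ball Z (3 * t0)) G"
    and grad: "\<And>i x y X Y. \<lbrakk>x \<in> ball Z (3 * t0); y \<in> ball Z (3 * t0);
        t0 / 2^i / 2 \<le> dist x y; dist x y < t0 / 2^i; X \<ge> 0; Y \<ge> 0; u i x \<le> ennreal X; u i y \<le> ennreal Y\<rbrakk>
      \<Longrightarrow> \<bar>G x - G y\<bar> \<le> (t0 / 2^i) powr s * (X powr (1/p) + Y powr (1/p))"
    and int: "\<And>i. (\<integral>\<^sup>+x. u i x * indicator {x. \<bar>dist Z x - \<tau>\<bar> < 4 * (t0 / 2^i)} x \<partial>lebesgue) \<le> ennreal (\<beta> i powr p)"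
    and \<beta>: "\<And>i. \<beta> i > 0" "summable \<beta>"
    and AB: "A \<in> sphere Z \<tau>" "B \<in> sphere Z \<tau>"
  shows "\<bar>G A - G B\<bar> \<le> 4 * K powr (1/p) * suminf \<beta>"
proof -
  have t0: "t0 > 0" using \<tau> by simp
  obtain b :: 'a where "b \<in> Basis" using nonempty_Basis by blast
  then have v: "norm ((3/2) *\<^sub>R b) = 3/2" by simp
  define v where "v = (3/2) *\<^sub>R b"
  note v = v[folded v_def]
  \<comment> \<open>The radius leaves room for moving the base point: \<open>z0\<close> is within
    \<open>t0/16 + \<tau> < t0/8\<close> of \<open>a + t0 *\<^sub>R v\<close> for every
    \<open>a\<close> on the sphere.\<close>
  let ?b = "ball (Z + t0 *\<^sub>R v) (t0 / 16)"
  have sub: "?b \<subseteq> {x. \<bar>dist Z x - \<tau>\<bar> < 4 * (t0 / 2^0)}"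
  proof
    fix z assume "z \<in> ?b"
    then have "dist (Z + t0 *\<^sub>R v) z < t0 / 16" by simp
    moreover have "dist Z (Z + t0 *\<^sub>R v) = t0 * (3/2)" using v t0 by (simp add: dist_norm)
    ultimately have "dist Z z < 2 * t0"
      using dist_triangle[of Z z "Z + t0 *\<^sub>R v"] t0 by linarith
    then have "\<bar>dist Z z - \<tau>\<bar> < 4 * t0" using \<tau> zero_le_dist[of Z z] by linarith
    then show "z \<in> {x. \<bar>dist Z x - \<tau>\<bar> < 4 * (t0 / 2^0)}" by simp
  qed
  have "(\<integral>\<^sup>+x. u 0 x * indicator ?b x \<partial>lebesgue) \<le> ennreal (\<beta> 0 powr p)"
  proof -
    have "(\<integral>\<^sup>+x. u 0 x * indicator ?b x \<partial>lebesgue) \<le> (\<integral>\<^sup>+x. u 0 x * indicator {x. \<bar>dist Z x - \<tau>\<bar> < 4 * (t0 / 2^0)} x \<partial>lebesgue)"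
      using sub by (intro nn_integral_mono mult_left_mono) (auto simp: indicator_def simp del: mem_ball)
    also note int
    finally show ?thesis .
  qed
  then have "\<exists>z\<in>?b. u 0 z \<le> ennreal (3 * \<beta> 0 powr p / measure lborel ?b) \<and> u 0 z \<le> ennreal (3 * \<beta> 0 powr p / measure lborel ?b)"
    using \<beta>(1) t0 by (intro exists_point_below_averages u) (auto simp: less_imp_neq[OF \<beta>(1), symmetric])
  moreover have "3 * \<beta> 0 powr p / measure lborel ?b = K * \<beta> 0 powr p / t0 ^ DIM('a)"
    using t0 by (subst content_ball) (auto simp: K_def power_divide)
  ultimately obtain z0 where z0: "dist (Z + t0 *\<^sub>R v) z0 < t0 / 16" "u 0 z0 \<le> ennreal (K * \<beta> 0 powr p / t0 ^ DIM('a))"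
    by (auto simp: mem_ball)
  have est: "\<bar>G a - G z0\<bar> \<le> 2 * K powr (1/p) * suminf \<beta>" if a: "a \<in> sphere Z \<tau>" for a
  proof -
    have da: "dist Z a = \<tau>" using a by simp
    have sub: "ball a (2 * t0) \<subseteq> ball Z (3 * t0)"
      using da \<tau> t0 by (intro ball_subset_ball_iff[THEN iffD2]) (simp add: dist_commute)
    show ?thesis unfolding K_def
    proof (rule chain_estimate[OF p t0 v u])
      have "a \<in> ball Z (3 * t0)" using da \<tau> t0 by simp
      then show "isCont G a" using cont by (simp add: continuous_on_eq_continuous_at)
      show "(\<integral>\<^sup>+x. u i x * indicator (ball a (4 * (t0 / 2^i))) x \<partial>lebesgue) \<le> ennreal (\<beta> i powr p)" for i
      proof -
        have "ball a (4 * (t0 / 2^i)) \<subseteq> {x. \<bar>dist Z x - \<tau>\<bar> < 4 * (t0 / 2^i)}"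
        proof
          fix x assume "x \<in> ball a (4 * (t0 / 2^i))"
          then have "dist a x < 4 * (t0 / 2^i)" by simp
          moreover have "\<bar>dist Z x - dist Z a\<bar> \<le> dist a x"
            using dist_triangle[of Z x a] dist_triangle[of Z a x] by (simp add: dist_commute)
          ultimately show "x \<in> {x. \<bar>dist Z x - \<tau>\<bar> < 4 * (t0 / 2^i)}" using da by simp
        qed
        then have "(\<integral>\<^sup>+x. u i x * indicator (ball a (4 * (t0 / 2^i))) x \<partial>lebesgue) \<le> (\<integral>\<^sup>+x. u i x * indicator {x. \<bar>dist Z x - \<tau>\<bar> < 4 * (t0 / 2^i)} x \<partial>lebesgue)"
          by (intro nn_integral_mono mult_left_mono) (auto simp: indicator_def simp del: mem_ball)
        also note int
        finally show ?thesis .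
      qed
      have "dist (a + t0 *\<^sub>R v) (Z + t0 *\<^sub>R v) = \<tau>" using da by (simp add: dist_commute)
      then show "dist (a + t0 *\<^sub>R v) z0 < t0 / 8"
        using z0(1) \<tau> dist_triangle[of "a + t0 *\<^sub>R v" z0 "Z + t0 *\<^sub>R v"] by linarith
      show "\<bar>G x - G y\<bar> \<le> (t0 / 2^i) powr s * (X powr (1/p) + Y powr (1/p))"
        if "x \<in> ball a (2 * t0)" "y \<in> ball a (2 * t0)" "t0 / 2^i / 2 \<le> dist x y" "dist x y < t0 / 2^i"
          "X \<ge> 0" "Y \<ge> 0" "u i x \<le> ennreal X" "u i y \<le> ennreal Y" for i x y X Y
        by (rule grad[OF subsetD[OF sub that(1)] subsetD[OF sub that(2)] that(3-)])
    qed (use z0 \<beta> in \<open>auto simp: K_def simp del: mem_ball\<close>)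
  qed
  show ?thesis using est[OF AB(1)] est[OF AB(2)] by linarith
qed

section \<open>Powers on \<open>[0, \<infinity>]\<close>\<close>

lemma ennreal_powr_ennreal [simp]: "a \<ge> 0 \<Longrightarrow> ennreal_powr (ennreal a) b = ennreal (a powr b)"
  by (simp add: ennreal_powr_def)

lemma ennreal_powr_top [simp]: "ennreal_powr top b = top"
  by (simp add: ennreal_powr_def)

lemma ennreal_powr_0 [simp]: "ennreal_powr 0 b = 0"
  by (simp add: ennreal_powr_def)

lemma ennreal_powr_mono:
  assumes "x \<le> y" "b > 0"
  shows "ennreal_powr x b \<le> ennreal_powr y b"
  using assms by (cases x; cases y) (auto simp: top_unique powr_mono2)

lemma ennreal_powr_le_iff:
  assumes "b > 0" "c \<ge> 0"
  shows "ennreal_powr x b \<le> ennreal c \<longleftrightarrow> x \<le> ennreal (c powr (1/b))"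
proof (cases x)
  case (real a)
  have "a powr b \<le> c \<longleftrightarrow> a \<le> c powr (1/b)"
  proof
    assume "a powr b \<le> c"
    then have "(a powr b) powr (1/b) \<le> c powr (1/b)" using assms by (intro powr_mono2) auto
    then show "a \<le> c powr (1/b)" using assms real by (simp add: powr_powr)
  next
    assume "a \<le> c powr (1/b)"
    then have "a powr b \<le> (c powr (1/b)) powr b" using assms real by (intro powr_mono2) auto
    then show "a powr b \<le> c" using assms by (simp add: powr_powr)
  qed
  then show ?thesis using real assms by simp
qed (auto simp: top_unique)

lemma borel_measurable_ennreal_powr [measurable (raw)]:
  assumes [measurable]: "f \<in> borel_measurable M"
  shows "(\<lambda>x. ennreal_powr (f x) b) \<in> borel_measurable M"
  unfolding ennreal_powr_def by measurable

section \<open>Test functions and upper bounds for their norms\<close>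

lemma sum_power_abs_diff_le:
  fixes x :: real
  assumes x: "0 < x" "x < 1" and "finite F"
  shows "(\<Sum>k\<in>F. x ^ nat \<bar>k - m\<bar>) \<le> 2 / (1 - x)"
proof -
  have half: "(\<Sum>k\<in>H. x ^ nat \<bar>k - m\<bar>) \<le> 1 / (1 - x)"
    if "finite H" "inj_on (\<lambda>k. nat \<bar>k - m\<bar>) H" for H
  proof -
    have "(\<Sum>k\<in>H. x ^ nat \<bar>k - m\<bar>) = (\<Sum>i\<in>(\<lambda>k. nat \<bar>k - m\<bar>) ` H. x ^ i)"
      using that by (simp add: sum.reindex)
    also have "\<dots> \<le> (\<Sum>i. x ^ i)"
      using x that by (intro sum_le_suminf) auto
    also have "\<dots> = 1 / (1 - x)" using x by (simp add: suminf_geometric)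
    finally show ?thesis .
  qed
  have "(\<Sum>k\<in>F. x ^ nat \<bar>k - m\<bar>) = (\<Sum>k\<in>F \<inter> {m..}. x ^ nat \<bar>k - m\<bar>) + (\<Sum>k\<in>F - {m..}. x ^ nat \<bar>k - m\<bar>)"
    using sum.Int_Diff[OF \<open>finite F\<close>] .
  also have "\<dots> \<le> 1 / (1 - x) + 1 / (1 - x)"
    using \<open>finite F\<close> by (intro add_mono half) (auto simp: inj_on_def)
  finally show ?thesis by simp
qed

text \<open>The gradient is a constant \<open>a k\<close> on \<open>S\<close>. At scales below
  \<open>r\<close> the Lipschitz bound gains \<open>2 powr (- (1 - s) * (k - m))\<close>, at scales
  above \<open>r\<close> the bound on \<open>F\<close> gains \<open>2 powr (- s * (m - k))\<close>;
  \<open>\<rho> s\<close> is the slower of the two rates. As \<open>s * p = DIM('a)\<close>, the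
  measure of \<open>S\<close> to the power \<open>1/p\<close> contributes \<open>r powr s\<close>,
  which cancels the \<open>r powr (- s)\<close> in \<open>a k\<close>.\<close>

lemma besov_norm_le_of_lipschitz_support:
  fixes F :: "'a::euclidean_space \<Rightarrow> real"
  defines "\<omega> \<equiv> unit_ball_vol (real DIM('a))"
  defines "\<rho> \<equiv> \<lambda>s::real. 2 powr (- min s (1 - s))"
  assumes s: "0 < s" "s < 1" and p: "p > 0" "s * p = real DIM('a)" and "q > 0" and "r > 0" and \<Omega>: "\<Omega> \<in> sets lebesgue"
    and bound: "\<And>x. \<bar>F x\<bar> \<le> 1" and lip: "\<And>x y. \<bar>F x - F y\<bar> \<le> 2 / r * dist x y"
    and supp: "\<And>x. x \<notin> S \<Longrightarrow> F x = 0"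
    and S: "S \<in> sets lebesgue" "emeasure lebesgue S \<le> ennreal (N * (\<omega> * (3 * r) ^ DIM('a)))" and "N \<ge> 0"
  shows "besov_norm s p q \<Omega> F
    \<le> ennreal (8 * 3 powr s * \<omega> powr (1/p) * (2 / (1 - \<rho> s powr q)) powr (1/q) * N powr (1/p))"
proof -
  define \<delta> where "\<delta> = min s (1 - s)"
  have \<delta>: "0 < \<delta>" "\<delta> \<le> s" "\<delta> \<le> 1 - s" using s by (auto simp: \<delta>_def)
  have \<omega>: "\<omega> > 0" by (simp add: \<omega>_def)
  define R where "R = \<rho> s"
  have R: "0 < R" "R < 1" and R_def': "R = 2 powr (- \<delta>)"
    using \<delta>(1) powr_less_cancel_iff[of 2 "-\<delta>" 0] by (auto simp: R_def \<rho>_def \<delta>_def)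
  define m where "m = - \<lfloor>log 2 r\<rfloor>"
  have "2 powr (real_of_int (- m)) \<le> 2 powr (log 2 r)" "2 powr (log 2 r) < 2 powr (real_of_int (- m) + 1)"
    unfolding m_def by (auto simp del: powr_log_cancel)
  then have m: "2 powr (- real_of_int m) \<le> r" "r < 2 powr (1 - real_of_int m)"
    using \<open>r > 0\<close> by (auto simp: algebra_simps)
  \<comment> \<open>The factor 8 comes from the coarse scales: two values of \<open>F\<close> differ
    by at most 2, and dyadic rounding loses a factor 4.\<close>
  define a where "a k = 8 * r powr (- s) * R ^ nat \<bar>k - m\<bar>" for k
  have a: "a k > 0" for k using R \<open>r > 0\<close> by (simp add: a_def)
  define g where "g k x = ennreal (a k) * indicator S x" for k x
  have key: "\<bar>F x - F y\<bar> \<le> dist x y powr s * a k"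
    if D: "2 powr (- real_of_int k - 1) \<le> dist x y" "dist x y < 2 powr (- real_of_int k)" for x y k
  proof -
    let ?D = "dist x y"
    have D0: "?D > 0" using D(1) by (smt (verit) powr_gt_zero)
    show ?thesis
    proof (cases "k \<ge> m")
      case True
      have RR: "R ^ nat \<bar>k - m\<bar> = 2 powr (- \<delta> * (real_of_int k - m))"
        using True R by (simp add: R_def' powr_powr powr_realpow[symmetric])
      have "?D / r \<le> 2 powr (- (real_of_int k - m))"
      proof -
        have "?D \<le> 2 powr (- (real_of_int k - m)) * 2 powr (- real_of_int m)"
          using D by (simp add: powr_add[symmetric])
        also have "\<dots> \<le> 2 powr (- (real_of_int k - m)) * r" using m by simp
        finally show ?thesis using \<open>r > 0\<close> by (simp add: field_simps)
      qed
      then have "(?D / r) powr (1 - s) \<le> (2 powr (- (real_of_int k - m))) powr (1 - s)"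
        using s D0 \<open>r > 0\<close> by (intro powr_mono2) auto
      moreover have "(2 powr (- (real_of_int k - m))) powr (1 - s) = 2 powr (- (1 - s) * (real_of_int k - m))"
        by (simp add: powr_powr algebra_simps)
      moreover have "2 powr (- (1 - s) * (real_of_int k - m)) \<le> 2 powr (- \<delta> * (real_of_int k - m))"
        using \<delta> True by (intro powr_mono mult_right_mono) auto
      ultimately have "(?D / r) powr (1 - s) \<le> 2 powr (- \<delta> * (real_of_int k - m))" by linarith
      moreover have "?D / r = ?D powr s * r powr (- s) * (?D / r) powr (1 - s)"
        using D0 \<open>r > 0\<close> by (simp add: powr_divide powr_diff powr_minus field_simps)
      ultimately have "?D / r \<le> ?D powr s * r powr (- s) * R ^ nat \<bar>k - m\<bar>"
        using mult_left_mono[of "(?D / r) powr (1 - s)" "2 powr (- \<delta> * (real_of_int k - m))" "?D powr s * r powr (- s)"]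
        by (simp add: RR)
      then show ?thesis using lip[of x y] a[of k] by (simp add: a_def)
    next
      case False
      have RR: "R ^ nat \<bar>k - m\<bar> = 2 powr (- \<delta> * (real_of_int m - k))"
        using False R by (simp add: R_def' powr_powr powr_realpow[symmetric])
      have "r / ?D \<le> 4 * 2 powr (- (real_of_int m - k))"
      proof -
        have "r \<le> 4 * 2 powr (- (real_of_int m - k)) * 2 powr (- real_of_int k - 1)"
          using m by (simp add: powr_add[symmetric] powr_diff powr_minus field_simps)
        also have "\<dots> \<le> 4 * 2 powr (- (real_of_int m - k)) * ?D" using D by simp
        finally show ?thesis using D0 by (simp add: field_simps)
      qed
      then have "(r / ?D) powr s \<le> (4 * 2 powr (- (real_of_int m - k))) powr s"
        using s D0 \<open>r > 0\<close> by (intro powr_mono2) auto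
      also have "\<dots> = 4 powr s * 2 powr (- s * (real_of_int m - k))" by (simp add: powr_mult powr_powr algebra_simps)
      also have "\<dots> \<le> 4 powr 1 * 2 powr (- \<delta> * (real_of_int m - k))"
      proof -
        have "- s * (real_of_int m - k) \<le> - \<delta> * (real_of_int m - k)"
          using \<delta> False by (intro mult_right_mono) auto
        then have "(2::real) powr (- s * (real_of_int m - k)) \<le> 2 powr (- \<delta> * (real_of_int m - k))"
          by (rule powr_mono) simp
        moreover have "(4::real) powr s \<le> 4 powr 1" using s by (intro powr_mono) auto
        ultimately show ?thesis by (intro mult_mono) auto
      qed
      finally have "(r / ?D) powr s \<le> 4 * 2 powr (- \<delta> * (real_of_int m - k))" by simp
      moreover have "1 = ?D powr s * r powr (- s) * (r / ?D) powr s"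
        using D0 \<open>r > 0\<close> by (simp add: powr_divide powr_minus field_simps)
      ultimately have "1 \<le> ?D powr s * r powr (- s) * (4 * R ^ nat \<bar>k - m\<bar>)"
        using mult_left_mono[of "(r / ?D) powr s" "4 * 2 powr (- \<delta> * (real_of_int m - k))" "?D powr s * r powr (- s)"]
        by (simp add: RR)
      then show ?thesis using bound[of x] bound[of y] by (simp add: a_def)
    qed
  qed
  have "hajlasz_gradient s \<Omega> F g"
    unfolding hajlasz_gradient_def
  proof (intro conjI allI ballI impI)
    show "g k \<in> borel_measurable (lebesgue_on \<Omega>)" for k
      unfolding g_def using S(1)
      by (intro measurable_restrict_space1 borel_measurable_times_ennreal borel_measurable_const borel_measurable_indicator)
    fix k x y assume "x \<in> \<Omega>" "y \<in> \<Omega>" and D: "2 powi (- k - 1) \<le> norm (x - y) \<and> norm (x - y) < 2 powi (- k)"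
    show "ennreal \<bar>F x - F y\<bar> \<le> ennreal (norm (x - y) powr s) * (g k x + g k y)"
    \<comment> \<open>One point in \<open>S\<close> is enough, since the two gradient values then
      add up to at least \<open>a k\<close>; off \<open>S\<close> both values of \<open>F\<close>
      vanish.\<close>
    proof (cases "x \<in> S \<or> y \<in> S")
      case True
      have "2 powi j = 2 powr real_of_int j" for j by (simp add: powr_real_of_int')
      then have "\<bar>F x - F y\<bar> \<le> dist x y powr s * a k" using D by (intro key) (auto simp: dist_norm)
      then have "ennreal \<bar>F x - F y\<bar> \<le> ennreal (dist x y powr s) * ennreal (a k)"
        by (simp add: ennreal_mult[symmetric] a less_imp_le ennreal_leI)
      also have "\<dots> \<le> ennreal (dist x y powr s) * (g k x + g k y)"
        using True by (intro mult_left_mono) (auto simp: g_def)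
      finally show ?thesis by (simp add: dist_norm)
    qed (simp add: supp)
  qed
  then have "besov_norm s p q \<Omega> F \<le> ennreal_powr (\<Sum>\<^sub>\<infinity>k::int. ennreal_powr (Lp_norm p \<Omega> (g k)) q) (1 / q)"
    unfolding besov_norm_def by (intro INF_lower) simp
  also have "\<dots> \<le> ennreal_powr (ennreal ((8 * 3 powr s * \<omega> powr (1/p) * N powr (1/p)) powr q * (2 / (1 - R powr q)))) (1 / q)"
  proof (intro ennreal_powr_mono)
    define A where "A = 8 * 3 powr s * \<omega> powr (1/p) * N powr (1/p)"
    have A: "A \<ge> 0" by (simp add: A_def)
    have Lp: "Lp_norm p \<Omega> (g k) \<le> ennreal (A * R ^ nat \<bar>k - m\<bar>)" for k
    proof -
      have pw: "ennreal_powr (g k x) p = ennreal (a k powr p) * indicator S x" for x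
        using a[of k] by (auto simp: g_def indicator_def less_imp_le)
      have "(\<integral>\<^sup>+x. ennreal_powr (g k x) p \<partial>lebesgue_on \<Omega>) \<le> (\<integral>\<^sup>+x. ennreal (a k powr p) * indicator S x \<partial>lebesgue)"
        unfolding pw using \<Omega> by (subst nn_integral_restrict_space) (auto intro!: nn_integral_mono simp: indicator_def)
      also have "\<dots> = ennreal (a k powr p) * emeasure lebesgue S" using S by (simp add: nn_integral_cmult_indicator)
      also have "\<dots> \<le> ennreal (a k powr p) * ennreal (N * (\<omega> * (3 * r) ^ DIM('a)))" by (intro mult_left_mono S) simp
      also have "\<dots> = ennreal (a k powr p * (N * (\<omega> * (3 * r) ^ DIM('a))))"
        using \<omega> \<open>N \<ge> 0\<close> \<open>r > 0\<close> by (simp add: ennreal_mult)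
      finally have "Lp_norm p \<Omega> (g k) \<le> ennreal_powr (ennreal (a k powr p * (N * (\<omega> * (3 * r) ^ DIM('a))))) (1/p)"
        unfolding Lp_norm_def using p by (intro ennreal_powr_mono) auto
      also have "\<dots> = ennreal ((a k powr p * (N * (\<omega> * (3 * r) ^ DIM('a)))) powr (1/p))"
        using \<omega> \<open>N \<ge> 0\<close> \<open>r > 0\<close> by (intro ennreal_powr_ennreal) auto
      also have "(a k powr p * (N * (\<omega> * (3 * r) ^ DIM('a)))) powr (1/p)
          = a k * (N powr (1/p) * (\<omega> powr (1/p) * (3 powr s * r powr s)))"
      proof -
        have "s = real DIM('a) / p" using p by (simp add: field_simps)
        then have "((3 * r) ^ DIM('a)) powr (1/p) = 3 powr s * r powr s"
          using \<open>r > 0\<close> by (simp add: powr_realpow[symmetric] powr_powr powr_mult)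
        then show ?thesis using a[of k] p \<omega> \<open>N \<ge> 0\<close> \<open>r > 0\<close> by (simp add: powr_mult powr_powr)
      qed
      also have "\<dots> = A * R ^ nat \<bar>k - m\<bar>" using \<open>r > 0\<close> by (simp add: a_def A_def powr_minus field_simps)
      finally show ?thesis .
    qed
    have "(\<Sum>\<^sub>\<infinity>k::int. ennreal_powr (Lp_norm p \<Omega> (g k)) q)
        = (SUP H\<in>{H. finite H \<and> H \<subseteq> UNIV}. \<Sum>k\<in>H. ennreal_powr (Lp_norm p \<Omega> (g k)) q)"
      by (intro nonneg_infsum_complete) simp
    also have "\<dots> \<le> ennreal (A powr q * (2 / (1 - R powr q)))"
    proof (intro SUP_least)
      fix H :: "int set" assume "H \<in> {H. finite H \<and> H \<subseteq> UNIV}"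
      then have H: "finite H" by simp
      have "(\<Sum>k\<in>H. ennreal_powr (Lp_norm p \<Omega> (g k)) q) \<le> (\<Sum>k\<in>H. ennreal (A powr q * (R powr q) ^ nat \<bar>k - m\<bar>))"
      proof (intro sum_mono)
        fix k
        have "ennreal_powr (Lp_norm p \<Omega> (g k)) q \<le> ennreal_powr (ennreal (A * R ^ nat \<bar>k - m\<bar>)) q"
          by (intro ennreal_powr_mono Lp \<open>q > 0\<close>)
        also have "\<dots> = ennreal ((A * R ^ nat \<bar>k - m\<bar>) powr q)"
          using A R by (intro ennreal_powr_ennreal) auto
        also have "(A * R ^ nat \<bar>k - m\<bar>) powr q = A powr q * (R powr q) ^ nat \<bar>k - m\<bar>"
          using A R by (simp add: powr_mult powr_powr powr_realpow[symmetric] mult.commute)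
        finally show "ennreal_powr (Lp_norm p \<Omega> (g k)) q \<le> ennreal (A powr q * (R powr q) ^ nat \<bar>k - m\<bar>)" .
      qed
      also have "\<dots> = ennreal (A powr q * (\<Sum>k\<in>H. (R powr q) ^ nat \<bar>k - m\<bar>))"
        using R by (simp add: sum_ennreal sum_distrib_left)
      also have "\<dots> \<le> ennreal (A powr q * (2 / (1 - R powr q)))"
        using R \<open>q > 0\<close> powr_less_mono2[of q R 1] by (intro ennreal_leI mult_left_mono sum_power_abs_diff_le H) auto
      finally show "(\<Sum>k\<in>H. ennreal_powr (Lp_norm p \<Omega> (g k)) q) \<le> ennreal (A powr q * (2 / (1 - R powr q)))" .
    qed
    finally show "(\<Sum>\<^sub>\<infinity>k::int. ennreal_powr (Lp_norm p \<Omega> (g k)) q) \<le> ennreal (A powr q * (2 / (1 - R powr q)))" .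
  qed (use \<open>q > 0\<close> in simp)
  also have "\<dots> = ennreal (((8 * 3 powr s * \<omega> powr (1/p) * N powr (1/p)) powr q * (2 / (1 - R powr q))) powr (1/q))"
    using R \<open>q > 0\<close> powr_less_mono2[of q R 1] by (intro ennreal_powr_ennreal) auto
  also have "((8 * 3 powr s * \<omega> powr (1/p) * N powr (1/p)) powr q * (2 / (1 - R powr q))) powr (1/q)
      = 8 * 3 powr s * \<omega> powr (1/p) * (2 / (1 - \<rho> s powr q)) powr (1/q) * N powr (1/p)"
  proof -
    have "(A powr q * B) powr (1/q) = A * B powr (1/q)" if "A \<ge> 0" for A B :: real
      using that \<open>q > 0\<close> by (simp add: powr_mult powr_powr)
    note eq = this
    show ?thesis unfolding R_def by (subst eq) simp_all
  qed
  finally show ?thesis .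
qed

text \<open>The phase \<open>z \<bullet> b / r\<close> does not depend on the points of \<open>X\<close>, so overlaps of their neighbourhoods do
  no harm; using both \<open>cos\<close> and \<open>sin\<close> in every coordinate detects any displacement of length
  \<open>r / 20\<close> near \<open>X\<close>.\<close>

definition bump :: "real \<Rightarrow> 'a::euclidean_space set \<Rightarrow> 'a \<Rightarrow> real" where
  "bump r X z = max 0 (min 1 (3 - infdist z X / r))"

definition wave :: "real \<Rightarrow> 'a::euclidean_space set \<Rightarrow> 'a \<times> (real \<Rightarrow> real) \<Rightarrow> 'a \<Rightarrow> real" where
  "wave r X l z = bump r X z * snd l (z \<bullet> fst l / r)"

abbreviation wave_index :: "('a::euclidean_space \<times> (real \<Rightarrow> real)) set" where
  "wave_index \<equiv> Basis \<times> {cos, sin}"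

lemma bump_bounds: "0 \<le> bump r X z" "bump r X z \<le> 1"
  by (auto simp: bump_def)

lemma bump_lipschitz:
  assumes "r > 0"
  shows "\<bar>bump r X x - bump r X y\<bar> \<le> dist x y / r"
proof -
  have "\<bar>infdist x X / r - infdist y X / r\<bar> \<le> dist x y / r"
    using infdist_triangle_abs[of x X y] assms by (simp add: divide_right_mono diff_divide_distrib[symmetric] abs_divide)
  then show ?thesis unfolding bump_def by linarith
qed

lemma abs_cos_diff_le: "\<bar>cos x - cos y\<bar> \<le> \<bar>x - y\<bar>" for x y :: real
proof -
  have "\<bar>cos x - cos y\<bar> = 2 * (\<bar>sin ((x + y) / 2)\<bar> * \<bar>sin ((y - x) / 2)\<bar>)"
    by (simp add: cos_diff_cos abs_mult)
  also have "\<dots> \<le> 2 * (1 * \<bar>(y - x) / 2\<bar>)"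
    by (intro mult_left_mono mult_mono abs_sin_x_le_abs_x) auto
  finally show ?thesis by (simp add: abs_minus_commute)
qed

lemma abs_sin_diff_le: "\<bar>sin x - sin y\<bar> \<le> \<bar>x - y\<bar>" for x y :: real
  using abs_cos_diff_le[of "pi/2 - x" "pi/2 - y"] by (simp add: cos_diff)

lemma wave_bounds:
  assumes "l \<in> wave_index"
  shows "\<bar>wave r X l z\<bar> \<le> 1"
proof -
  have "\<bar>snd l t\<bar> \<le> 1" for t using assms by auto
  then show ?thesis using bump_bounds[of r X z] by (auto simp: wave_def abs_mult intro: mult_le_one)
qed

lemma wave_lipschitz:
  assumes "l \<in> wave_index" "r > 0"
  shows "\<bar>wave r X l x - wave r X l y\<bar> \<le> 2 / r * dist x y"
proof -
  let ?t = "\<lambda>z. snd l (z \<bullet> fst l / r)"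
  have b: "norm (fst l) = 1" using assms by auto
  have t: "\<bar>?t z\<bar> \<le> 1" for z using assms by auto
  have "\<bar>?t x - ?t y\<bar> \<le> \<bar>x \<bullet> fst l / r - y \<bullet> fst l / r\<bar>"
    using assms abs_cos_diff_le abs_sin_diff_le by auto
  also have "\<dots> = \<bar>(x - y) \<bullet> fst l\<bar> / r" using assms by (simp add: inner_diff_left diff_divide_distrib[symmetric])
  also have "\<dots> \<le> dist x y / r"
    using Cauchy_Schwarz_ineq2[of "x - y" "fst l"] assms b by (intro divide_right_mono) (auto simp: dist_norm)
  finally have 1: "\<bar>?t x - ?t y\<bar> \<le> dist x y / r" .
  have "wave r X l x - wave r X l y = (bump r X x - bump r X y) * ?t x + bump r X y * (?t x - ?t y)"
    by (simp add: wave_def algebra_simps)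
  then have "\<bar>wave r X l x - wave r X l y\<bar> \<le> \<bar>bump r X x - bump r X y\<bar> * \<bar>?t x\<bar> + \<bar>bump r X y\<bar> * \<bar>?t x - ?t y\<bar>"
    by (metis abs_mult abs_triangle_ineq)
  also have "\<dots> \<le> dist x y / r * 1 + 1 * (dist x y / r)"
    using bump_lipschitz[OF assms(2)] bump_bounds[of r X y] 1 t assms(2) by (intro add_mono mult_mono) auto
  finally show ?thesis by simp
qed

lemma continuous_on_wave:
  assumes "l \<in> wave_index"
  shows "continuous_on S (wave r X l)"
proof -
  have "continuous_on UNIV (snd l)" using assms by (auto intro!: continuous_intros)
  then have "continuous_on S (\<lambda>z. snd l (z \<bullet> fst l * inverse r))"
    by (rule continuous_on_compose2) (auto intro!: continuous_intros)
  moreover have "continuous_on S (\<lambda>z. max 0 (min 1 (3 - infdist z X * inverse r)))"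
    by (intro continuous_intros)
  ultimately show ?thesis
    unfolding wave_def bump_def divide_inverse by (intro continuous_on_mult)
qed

lemma wave_eq_0:
  assumes "X \<noteq> {}" "r > 0" "z \<notin> (\<Union>x\<in>X. cball x (3 * r))"
  shows "wave r X l z = 0"
proof -
  have "3 * r \<le> dist z x" if "x \<in> X" for x using assms(3) that by (auto simp: dist_commute not_le)
  then have "3 * r \<le> infdist z X" unfolding infdist_notempty[OF assms(1)] using assms(1) by (intro cINF_greatest) auto
  then have "3 - infdist z X / r \<le> 0" using assms(2) by (simp add: field_simps)
  then show ?thesis by (simp add: wave_def bump_def)
qed

text \<open>The support lies in at most \<open>N\<close> balls of radius \<open>3 * r\<close>, whose
  volumes are simply added. The constant is fixed before \<open>r\<close>, \<open>X\<close>,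
  \<open>l\<close> and \<open>\<Omega>\<close>.\<close>

lemma besov_norm_wave_le:
  fixes X :: "'a::euclidean_space set"
  assumes s: "0 < s" "s < 1" and p: "p > 0" "s * p = real DIM('a)" and "q > 0"
  obtains C where "C \<ge> 0"
    "\<And>r X l \<Omega> (N::nat). \<lbrakk>r > 0; l \<in> wave_index; finite X; X \<noteq> {}; card X \<le> N; \<Omega> \<in> sets lebesgue\<rbrakk>
      \<Longrightarrow> besov_norm s p q \<Omega> (wave r (X::'a set) l) \<le> ennreal (C * real N powr (1/p))"
proof -
  define \<omega> where "\<omega> = unit_ball_vol (real DIM('a))"
  define C where "C = 8 * 3 powr s * \<omega> powr (1/p) * (2 / (1 - (2 powr (- min s (1 - s))) powr q)) powr (1/q)"
  have \<omega>: "\<omega> \<ge> 0" by (simp add: \<omega>_def)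
  show thesis
  proof (rule that[of C])
    show "C \<ge> 0" by (simp add: C_def)
    fix r :: real and X \<Omega> :: "'a set" and l :: "'a \<times> (real \<Rightarrow> real)" and N :: nat
    assume A: "r > 0" "l \<in> wave_index" "finite X" "X \<noteq> {}" "card X \<le> N" "\<Omega> \<in> sets lebesgue"
    let ?S = "\<Union>x\<in>X. cball x (3 * r)"
    have S: "closed ?S" using A(3) by (intro closed_UN) auto
    have "emeasure lebesgue ?S \<le> (\<Sum>x\<in>X. emeasure lebesgue (cball x (3 * r)))"
      using A(3) by (intro emeasure_subadditive_finite) auto
    also have "\<dots> = (\<Sum>x\<in>X. ennreal (\<omega> * (3 * r) ^ DIM('a)))"
      using A(1) by (simp add: emeasure_cball \<omega>_def)
    also have "\<dots> = ennreal (real (card X) * (\<omega> * (3 * r) ^ DIM('a)))"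
      using A(1) \<omega> by (simp add: ennreal_mult ennreal_of_nat_eq_real_of_nat)
    also have "\<dots> \<le> ennreal (real N * (\<omega> * (3 * r) ^ DIM('a)))"
      using A \<omega> by (intro ennreal_leI mult_right_mono) auto
    finally have "emeasure lebesgue ?S \<le> ennreal (real N * (\<omega> * (3 * r) ^ DIM('a)))" .
    then show "besov_norm s p q \<Omega> (wave r X l) \<le> ennreal (C * real N powr (1/p))"
      unfolding C_def \<omega>_def
      by (intro besov_norm_le_of_lipschitz_support[where S = ?S and r = r] s p \<open>q > 0\<close> A wave_bounds wave_lipschitz wave_eq_0)
        (use S in auto)
  qed
qed

text \<open>The chord of the unit circle between the angles \<open>a\<close> and \<open>b\<close>
  has length \<open>2 * sin (\<bar>a - b\<bar> / 2)\<close>, at least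
  \<open>\<bar>a - b\<bar> / 2\<close> for such short arcs. So its two components cannot both be
  below \<open>\<bar>a - b\<bar> / 4\<close>.\<close>

lemma cos_or_sin_diff_ge:
  fixes a b :: real
  assumes "\<bar>a - b\<bar> \<le> 1"
  shows "\<bar>a - b\<bar> / 4 \<le> \<bar>cos a - cos b\<bar> \<or> \<bar>a - b\<bar> / 4 \<le> \<bar>sin a - sin b\<bar>"
proof (rule ccontr)
  assume "\<not> ?thesis"
  then have "\<bar>cos a - cos b\<bar> < \<bar>a - b\<bar> / 4" "\<bar>sin a - sin b\<bar> < \<bar>a - b\<bar> / 4" by auto
  then have lt: "(cos a - cos b)\<^sup>2 < (\<bar>a - b\<bar> / 4)\<^sup>2" "(sin a - sin b)\<^sup>2 < (\<bar>a - b\<bar> / 4)\<^sup>2"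
    by (metis abs_ge_zero power2_abs power_strict_mono pos2)+
  define x where "x = \<bar>a - b\<bar> / 2"
  have x: "0 \<le> x" "x \<le> 1/2" using assms by (auto simp: x_def)
  have sx: "x / 2 \<le> sin x"
  proof (cases "x = 0")
    case False
    then have "\<exists>z. 0 < z \<and> z < x \<and> sin x - sin 0 = (x - 0) * cos z"
      using x by (intro MVT2) (auto intro!: derivative_eq_intros)
    then obtain z where z: "0 < z" "z < x" "sin x = x * cos z" by auto
    have "cos (pi/3) \<le> cos z" using z x pi_gt3 by (intro cos_monotone_0_pi_le) auto
    then show ?thesis using z x by (simp add: cos_60 mult_left_mono)
  qed simp
  have "(cos a - cos b)\<^sup>2 + (sin a - sin b)\<^sup>2 = 2 - 2 * cos (a - b)"
    using sin_cos_squared_add[of a] sin_cos_squared_add[of b]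
    by (simp add: cos_diff power2_eq_square algebra_simps)
  also have "cos (a - b) = cos (2 * x)" by (simp add: x_def abs_if cos_diff)
  also have "2 - 2 * cos (2 * x) = 4 * (sin x)\<^sup>2" by (simp add: cos_double_sin)
  also have "\<dots> \<ge> 4 * (x / 2)\<^sup>2" using sx x by (intro mult_left_mono power_mono) auto
  finally show False using lt zero_le_square[of "a - b"] by (simp add: x_def power2_eq_square)
qed

text \<open>Both points lie within \<open>2 * r\<close> of \<open>X\<close>, where the cutoff is 1.
  Some coordinate carries at least \<open>r / (20 * DIM('a))\<close> of the displacement, so its
  phase changes by at least \<open>1 / (20 * DIM('a))\<close>, and \<open>cos\<close> or
  \<open>sin\<close> keeps a quarter of that.\<close>

lemma wave_oscillation:
  fixes A B :: "'a::euclidean_space"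
  assumes "r > 0" "x \<in> X" "A \<in> cball x r" "dist A B = r / 20"
  shows "\<exists>l\<in>wave_index. 1 / (80 * real DIM('a)) \<le> \<bar>wave r X l A - wave r X l B\<bar>"
proof -
  have "dist x A \<le> r" using assms by simp
  then have "dist A x \<le> 2 * r" "dist B x \<le> 2 * r"
    using dist_triangle[of B x A] assms by (auto simp: dist_commute)
  then have "infdist A X \<le> 2 * r" "infdist B X \<le> 2 * r"
    using infdist_le2[OF \<open>x \<in> X\<close>] by auto
  then have one: "bump r X A = 1" "bump r X B = 1"
    using \<open>r > 0\<close> by (auto simp: bump_def field_simps)
  have "\<exists>b\<in>Basis. norm (A - B) / DIM('a) \<le> \<bar>(A - B) \<bullet> b\<bar>"
  proof (rule ccontr)
    assume "\<not> ?thesis"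
    then have "(\<Sum>b\<in>Basis. \<bar>(A - B) \<bullet> b\<bar>) < (\<Sum>b\<in>(Basis::'a set). norm (A - B) / DIM('a))"
      by (intro sum_strict_mono) (auto simp: not_le)
    then show False using norm_le_l1[of "A - B"] by simp
  qed
  then obtain b where b: "b \<in> Basis" "r / 20 / DIM('a) \<le> \<bar>(A - B) \<bullet> b\<bar>"
    using assms(4) by (auto simp: dist_norm)
  have eq: "\<bar>A \<bullet> b / r - B \<bullet> b / r\<bar> = \<bar>(A - B) \<bullet> b\<bar> / r"
    using \<open>r > 0\<close> by (simp add: inner_diff_left diff_divide_distrib[symmetric])
  have "\<bar>(A - B) \<bullet> b\<bar> \<le> r / 20" using Basis_le_norm[OF b(1), of "A - B"] assms(4) by (simp add: dist_norm)
  then have "\<bar>A \<bullet> b / r - B \<bullet> b / r\<bar> \<le> 1" unfolding eq using \<open>r > 0\<close> by (simp add: field_simps)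
  then have "\<exists>T\<in>{cos, sin}. \<bar>A \<bullet> b / r - B \<bullet> b / r\<bar> / 4 \<le> \<bar>T (A \<bullet> b / r) - T (B \<bullet> b / r)\<bar>"
    using cos_or_sin_diff_ge by blast
  then obtain T where T: "T \<in> {cos, sin}" "\<bar>A \<bullet> b / r - B \<bullet> b / r\<bar> / 4 \<le> \<bar>T (A \<bullet> b / r) - T (B \<bullet> b / r)\<bar>" by blast
  have "1 / (80 * real DIM('a)) = r / 20 / DIM('a) / r / 4" using \<open>r > 0\<close> by simp
  also have "\<dots> \<le> \<bar>(A - B) \<bullet> b\<bar> / r / 4" using b \<open>r > 0\<close> by (intro divide_right_mono) auto
  also have "\<dots> \<le> \<bar>T (A \<bullet> b / r) - T (B \<bullet> b / r)\<bar>" using T eq by simp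
  finally have "1 / (80 * real DIM('a)) \<le> \<bar>wave r X (b, T) A - wave r X (b, T) B\<bar>" by (simp add: wave_def one)
  then show ?thesis using b T by (intro bexI[of _ "(b, T)"]) auto
qed

section \<open>Lower bound from one window of scales\<close>

lemma exists_dyadic_scale:
  assumes "d > (0::real)"
  obtains J :: int where "d \<le> 2 powi (- J)" "2 powi (- J) < 2 * d"
proof (rule that[of "- \<lceil>log 2 d\<rceil>"])
  have e: "2 powi j = 2 powr real_of_int j" for j by (simp add: powr_real_of_int')
  have "2 powr (log 2 d) \<le> 2 powr (real_of_int \<lceil>log 2 d\<rceil>)" by (simp del: powr_log_cancel)
  then show "d \<le> 2 powi (- (- \<lceil>log 2 d\<rceil>))" using assms by (simp add: e)
  have "2 powr (real_of_int \<lceil>log 2 d\<rceil>) < 2 powr (log 2 d + 1)"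
    by (intro powr_less_mono) linarith+
  then show "2 powi (- (- \<lceil>log 2 d\<rceil>)) < 2 * d" using assms by (simp add: e powr_add)
qed

text \<open>The window length \<open>m\<close> is fixed by data common to all pairs: beyond
  \<open>m\<close> scales, the decay of annular masses at a generic radius leaves a total
  contribution below \<open>c2\<close>. The oscillation \<open>c0\<close> must therefore come from
  the first \<open>m\<close> scales.\<close>

lemma oscillation_in_window:
  fixes \<phi> \<psi> :: "'a::euclidean_space \<Rightarrow> 'a" and I :: "'l set" and c0 :: real
  assumes dim: "DIM('a) \<ge> 2" and hom: "homeomorphism UNIV UNIV \<phi> \<psi>"
    and p: "p > 0" "s * p = real DIM('a)" and s: "0 < s" and I: "finite I" "I \<noteq> {}" and "\<Lambda> > 0"
  defines "c2 \<equiv> c0 / (16 * (3 * 16 ^ DIM('a) / unit_ball_vol (real DIM('a))) powr (1/p))"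
  assumes "c0 > 0"
  obtains m :: nat where
    "\<And>x y r d \<Omega> G h J. \<lbrakk>x \<noteq> y; r = dist x y; d = dist (\<psi> x) (\<psi> y); open \<Omega>; ball (\<psi> x) (256 * d) \<subseteq> \<Omega>;
      32 * d \<le> 2 powi (- J); 2 powi (- J) < 64 * d;
      \<And>l. l \<in> I \<Longrightarrow> continuous_on \<Omega> (G l);
      \<And>l. l \<in> I \<Longrightarrow> hajlasz_gradient s \<Omega> (G l) (h l);
      \<And>l k. l \<in> I \<Longrightarrow> (\<integral>\<^sup>+z. ennreal_powr (h l k z) p \<partial>lebesgue_on \<Omega>) \<le> ennreal \<Lambda>;
      \<And>A B. dist (\<phi> A) (\<phi> B) = r / 20 \<Longrightarrow> \<phi> A \<in> cball x r \<Longrightarrow> \<exists>l\<in>I. c0 \<le> \<bar>G l A - G l B\<bar>\<rbrakk>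
    \<Longrightarrow> \<exists>l\<in>I. ennreal c2 \<le> (\<Sum>i<m. Lp_norm p \<Omega> (h l (J + int i)))"
proof -
  define K1 where "K1 = (3 * 16 ^ DIM('a) / unit_ball_vol (real DIM('a))) powr (1/p)"
  have K1: "K1 > 0" by (simp add: K1_def less_imp_neq[OF unit_ball_vol_pos, symmetric])
  have c2: "c2 = c0 / (16 * K1)" "c2 > 0" using K1 \<open>c0 > 0\<close> by (auto simp: c2_def K1_def)
  define L where "L = real (card I) * \<Lambda>"
  have L: "L > 0" using I \<open>\<Lambda> > 0\<close> by (simp add: L_def card_gt_0_iff)
  \<comment> \<open>\<open>X\<close> and \<open>Y\<close> are the \<open>p\<close>-th roots of the
    decay rate and the constant in \<open>radius_selection\<close>, because \<open>\<beta>\<close>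
    bounds norms rather than their \<open>p\<close>-th powers.\<close>
  define X where "X = (3/4::real) powr (1/p)"
  have X: "0 < X" "X < 1" using p powr_less_mono2[of "1/p" "3/4" 1] by (auto simp: X_def)
  define Y where "Y = (4096 * L) powr (1/p)"
  have Y: "Y > 0" using L by (simp add: Y_def)
  have "(\<lambda>m. Y / (1 - X) * X ^ m) \<longlonglongrightarrow> Y / (1 - X) * 0"
    using X by (intro tendsto_intros LIMSEQ_power_zero) auto
  then have "\<forall>\<^sub>F m in sequentially. Y / (1 - X) * X ^ m < c2"
    using c2(2) by (auto dest: order_tendstoD(2))
  then obtain m where m: "Y / (1 - X) * X ^ m < c2"
    by (auto simp: eventually_sequentially)
  \<comment> \<open>\<open>exists_point_below_averages\<close> needs positive bounds, hence the small addend \<open>\<epsilon>\<close>.\<close>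
  define \<epsilon> where "\<epsilon> = c2 / (real m + 1)"
  have \<epsilon>: "\<epsilon> > 0" "real m * \<epsilon> \<le> c2" using c2(2) by (auto simp: \<epsilon>_def field_simps)
  show thesis
  proof (rule that[of m])
    fix x y :: 'a and r d :: real and \<Omega> :: "'a set" and G :: "'l \<Rightarrow> 'a \<Rightarrow> real"
      and h :: "'l \<Rightarrow> int \<Rightarrow> 'a \<Rightarrow> ennreal" and J :: int
    assume xy: "x \<noteq> y" and r: "r = dist x y" and d: "d = dist (\<psi> x) (\<psi> y)" and \<Omega>: "open \<Omega>" "ball (\<psi> x) (256 * d) \<subseteq> \<Omega>"
      and J: "32 * d \<le> 2 powi (- J)" "2 powi (- J) < 64 * d"
      and G: "\<And>l. l \<in> I \<Longrightarrow> continuous_on \<Omega> (G l)"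
      and h: "\<And>l. l \<in> I \<Longrightarrow> hajlasz_gradient s \<Omega> (G l) (h l)"
      and h\<Lambda>: "\<And>l k. l \<in> I \<Longrightarrow> (\<integral>\<^sup>+z. ennreal_powr (h l k z) p \<partial>lebesgue_on \<Omega>) \<le> ennreal \<Lambda>"
      and osc: "\<And>A B. dist (\<phi> A) (\<phi> B) = r / 20 \<Longrightarrow> \<phi> A \<in> cball x r \<Longrightarrow> \<exists>l\<in>I. c0 \<le> \<bar>G l A - G l B\<bar>"
    have "\<phi> (\<psi> z) = z" for z using hom by (auto simp: homeomorphism_def)
    then have "d > 0" using xy unfolding d by (metis zero_less_dist_iff)
    define t0 where "t0 = (2::real) powi (- J)"
    have t0: "32 * d \<le> t0" "t0 < 64 * d" "t0 > 0" using J by (auto simp: t0_def)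
    have ti: "t0 / 2 ^ i = 2 powi (- (J + int i))" for i
      by (simp add: t0_def power_int_diff power_int_minus field_simps power_int_add)
    have ti': "t0 / 2 ^ i / 2 = 2 powi (- (J + int i) - 1)" for i
      unfolding ti by (simp add: power_int_diff)
    define u where "u l i z = ennreal_powr (h l (J + int i) z) p * indicator \<Omega> z" for l and i :: nat and z
    have um[measurable]: "u l i \<in> borel_measurable lebesgue" if "l \<in> I" for l i
      using h[OF that] \<Omega>(1) unfolding u_def hajlasz_gradient_def
      by (subst borel_measurable_restrict_space_iff_ennreal[symmetric]) (auto intro: borel_measurable_ennreal_powr)
    have ui: "(\<integral>\<^sup>+z. u l i z \<partial>lebesgue) = (\<integral>\<^sup>+z. ennreal_powr (h l (J + int i) z) p \<partial>lebesgue_on \<Omega>)" for l i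
      unfolding u_def using \<Omega>(1) by (subst nn_integral_restrict_space) auto
    \<comment> \<open>The index \<open>l\<close> that detects the oscillation is known only after
      the radius has been chosen, so the radius is selected for the sum over all indices.\<close>
    define U where "U i z = (\<Sum>l\<in>I. u l i z)" for i z
    have Um: "U i \<in> borel_measurable lebesgue" for i
      unfolding U_def using um by (intro borel_measurable_sum) auto
    have UL: "(\<integral>\<^sup>+z. U i z \<partial>lebesgue) \<le> ennreal L" for i
    proof -
      have "(\<integral>\<^sup>+z. U i z \<partial>lebesgue) = (\<Sum>l\<in>I. \<integral>\<^sup>+z. u l i z \<partial>lebesgue)"
        unfolding U_def using um by (intro nn_integral_sum) auto
      also have "\<dots> \<le> (\<Sum>l\<in>I. ennreal \<Lambda>)" unfolding ui by (intro sum_mono h\<Lambda>)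
      also have "\<dots> = ennreal L" using \<open>\<Lambda> > 0\<close> by (simp add: L_def ennreal_mult ennreal_of_nat_eq_real_of_nat)
      finally show ?thesis .
    qed
    obtain Z where Z: "dist Z (\<psi> x) \<le> d"
      "\<And>\<tau>. d/2 < \<tau> \<Longrightarrow> \<tau> < d \<Longrightarrow> \<exists>A\<in>sphere Z \<tau>. \<exists>B\<in>sphere Z \<tau>. dist (\<phi> A) (\<phi> B) = r/20 \<and> \<phi> A \<in> cball x r"
      using oscillation_on_spheres[OF dim hom xy] unfolding r d by metis
    obtain \<tau> where \<tau>: "d/2 < \<tau>" "\<tau> < d"
      "\<And>i. (\<integral>\<^sup>+x. U i x * indicator {x. \<bar>dist Z x - \<tau>\<bar> < 4 * (t0 / 2^i)} x \<partial>lebesgue) \<le> ennreal (4096 * L * (3/4)^i)"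
      using radius_selection[where Z = Z and ?t0.0 = t0 and u = U, OF Um UL L \<open>d > 0\<close>] t0 by auto
    obtain A B where AB: "A \<in> sphere Z \<tau>" "B \<in> sphere Z \<tau>" "dist (\<phi> A) (\<phi> B) = r/20" "\<phi> A \<in> cball x r"
      using Z(2)[OF \<tau>(1,2)] by blast
    obtain l where l: "l \<in> I" "c0 \<le> \<bar>G l A - G l B\<bar>" using osc[OF AB(3,4)] by blast
    \<comment> \<open>\<open>3 * t0 + d < 193 * d\<close>, which is within the given radius
      \<open>256 * d\<close>.\<close>
    have sub: "ball Z (3 * t0) \<subseteq> \<Omega>"
    proof
      fix z assume "z \<in> ball Z (3 * t0)"
      then have "dist (\<psi> x) z < 256 * d"
        using dist_triangle[of "\<psi> x" z Z] Z(1) t0 by (auto simp: dist_commute)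
      then show "z \<in> \<Omega>" using \<Omega>(2) by auto
    qed
    define b where "b i = enn2real (Lp_norm p \<Omega> (h l (J + int i)))" for i
    have fin: "(\<integral>\<^sup>+z. u l i z \<partial>lebesgue) < top" for i
      using h\<Lambda>[OF l(1)] unfolding ui by (meson ennreal_less_top le_less_trans)
    have Lp: "Lp_norm p \<Omega> (h l (J + int i)) = ennreal (b i)" and b0: "b i \<ge> 0"
      and bp: "(\<integral>\<^sup>+z. u l i z \<partial>lebesgue) = ennreal (b i powr p)" for i
    proof -
      obtain c where c: "c \<ge> 0" "(\<integral>\<^sup>+z. u l i z \<partial>lebesgue) = ennreal c"
        using fin[of i] by (cases "\<integral>\<^sup>+z. u l i z \<partial>lebesgue") auto
      have e: "Lp_norm p \<Omega> (h l (J + int i)) = ennreal (c powr (1/p))"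
        unfolding Lp_norm_def ui[symmetric] c(2) using c(1) by simp
      then have b: "b i = c powr (1/p)" by (simp add: b_def)
      show "Lp_norm p \<Omega> (h l (J + int i)) = ennreal (b i)" using e b by simp
      show "b i \<ge> 0" by (simp add: b)
      show "(\<integral>\<^sup>+z. u l i z \<partial>lebesgue) = ennreal (b i powr p)"
        using c p by (simp add: b powr_powr)
    qed
    \<comment> \<open>The first \<open>m\<close> bounds are the norms themselves up to
      \<open>\<epsilon>\<close>, as these are to be estimated from below; only the tail uses the
      annular decay.\<close>
    define \<beta> where "\<beta> i = (if i < m then b i + \<epsilon> else Y * X ^ i)" for i
    have \<beta>: "\<beta> i > 0" for i using b0[of i] \<epsilon> X Y by (auto simp: \<beta>_def add_nonneg_pos)
    have s0: "(\<lambda>i. Y * X ^ (i + m)) sums (Y / (1 - X) * X ^ m)"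
    proof -
      have "(\<lambda>i. (Y * X ^ m) * X ^ i) sums ((Y * X ^ m) * (1 / (1 - X)))"
        using X by (intro sums_mult geometric_sums) auto
      then show ?thesis by (simp add: power_add mult_ac)
    qed
    have "(\<lambda>i. \<beta> (i + m)) = (\<lambda>i. Y * X ^ (i + m))" by (auto simp: \<beta>_def)
    with s0 have "(\<lambda>i. \<beta> (i + m)) sums (Y / (1 - X) * X ^ m)" by simp
    then have "\<beta> sums (Y / (1 - X) * X ^ m + (\<Sum>i<m. \<beta> i))" by (simp only: sums_iff_shift)
    then have sm: "summable \<beta>" and "suminf \<beta> = Y / (1 - X) * X ^ m + (\<Sum>i<m. \<beta> i)"
      by (auto simp: sums_iff)
    moreover have "(\<Sum>i<m. \<beta> i) = (\<Sum>i<m. b i) + real m * \<epsilon>"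
      by (simp add: \<beta>_def sum.distrib)
    ultimately have sb: "suminf \<beta> \<le> (\<Sum>i<m. b i) + c2 + c2" using m \<epsilon> by linarith
    have "\<bar>G l A - G l B\<bar> \<le> 4 * K1 * suminf \<beta>"
      unfolding K1_def
    proof (rule oscillation_on_sphere_le[OF p, where \<tau> = \<tau> and ?t0.0 = t0 and u = "u l" and Z = Z])
      show "0 < \<tau>" "\<tau> \<le> t0 / 32" using \<tau> t0 \<open>d > 0\<close> by auto
      show "continuous_on (ball Z (3 * t0)) (G l)" using G[OF l(1)] sub by (rule continuous_on_subset)
      show "(\<integral>\<^sup>+x. u l i x * indicator {x. \<bar>dist Z x - \<tau>\<bar> < 4 * (t0 / 2^i)} x \<partial>lebesgue) \<le> ennreal (\<beta> i powr p)" for i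
      proof (cases "i < m")
        case True
        have "(\<integral>\<^sup>+x. u l i x * indicator {x. \<bar>dist Z x - \<tau>\<bar> < 4 * (t0 / 2^i)} x \<partial>lebesgue) \<le> (\<integral>\<^sup>+x. u l i x \<partial>lebesgue)"
          by (intro nn_integral_mono) (auto simp: indicator_def)
        also have "\<dots> \<le> ennreal (\<beta> i powr p)"
          unfolding bp \<beta>_def using True b0[of i] \<epsilon> p by (auto intro!: ennreal_leI powr_mono2)
        finally show ?thesis .
      next
        case False
        have "(\<integral>\<^sup>+x. u l i x * indicator {x. \<bar>dist Z x - \<tau>\<bar> < 4 * (t0 / 2^i)} x \<partial>lebesgue)
            \<le> (\<integral>\<^sup>+x. U i x * indicator {x. \<bar>dist Z x - \<tau>\<bar> < 4 * (t0 / 2^i)} x \<partial>lebesgue)"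
          unfolding U_def using l(1) I(1) by (intro nn_integral_mono mult_right_mono member_le_sum) auto
        also have "\<dots> \<le> ennreal (4096 * L * (3/4)^i)" by (rule \<tau>(3))
        also have "4096 * L * (3/4)^i = \<beta> i powr p"
        proof -
          have "(X ^ i) powr p = (3/4) ^ i" using p by (simp add: X_def powr_powr powr_realpow[symmetric])
          then show ?thesis using False p L Y X by (simp add: \<beta>_def powr_mult Y_def powr_powr)
        qed
        finally show ?thesis .
      qed
      show "\<bar>G l x' - G l y'\<bar> \<le> (t0 / 2^i) powr s * (X' powr (1/p) + Y' powr (1/p))"
        if m: "x' \<in> ball Z (3 * t0)" "y' \<in> ball Z (3 * t0)" and D: "t0 / 2^i / 2 \<le> dist x' y'" "dist x' y' < t0 / 2^i"
          and XY: "X' \<ge> 0" "Y' \<ge> 0" "u l i x' \<le> ennreal X'" "u l i y' \<le> ennreal Y'" for i x' y' X' Y'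
      proof -
        have mem: "x' \<in> \<Omega>" "y' \<in> \<Omega>" using m sub by auto
        have hx: "h l (J + int i) x' \<le> ennreal (X' powr (1/p))" "h l (J + int i) y' \<le> ennreal (Y' powr (1/p))"
          using XY mem p by (auto simp: u_def ennreal_powr_le_iff)
        have "ennreal \<bar>G l x' - G l y'\<bar> \<le> ennreal (dist x' y' powr s) * (h l (J + int i) x' + h l (J + int i) y')"
          using h[OF l(1)] mem D unfolding hajlasz_gradient_def ti' unfolding ti dist_norm by blast
        also have "\<dots> \<le> ennreal ((t0 / 2^i) powr s) * (ennreal (X' powr (1/p)) + ennreal (Y' powr (1/p)))"
          using D s by (intro mult_mono add_mono hx ennreal_leI powr_mono2) auto
        also have "\<dots> = ennreal ((t0 / 2^i) powr s * (X' powr (1/p) + Y' powr (1/p)))"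
          by (simp add: ennreal_mult)
        finally show ?thesis by (subst (asm) ennreal_le_iff) auto
      qed
    qed (use um[OF l(1)] \<beta> sm AB in auto)
    also have "\<dots> \<le> 4 * K1 * ((\<Sum>i<m. b i) + c2 + c2)" using sb K1 by simp
    \<comment> \<open>By the choice of \<open>c2\<close> the oscillation accounts for
      \<open>4 * c2\<close>, of which the tail and the addends \<open>\<epsilon>\<close> take at
      most \<open>2 * c2\<close>.\<close>
    finally have "16 * K1 * c2 \<le> 4 * K1 * ((\<Sum>i<m. b i) + c2 + c2)" using l(2) K1 by (simp add: c2(1))
    then have "4 * c2 \<le> (\<Sum>i<m. b i) + c2 + c2" using K1 by simp
    then have "c2 \<le> (\<Sum>i<m. b i)" using c2(2) by simp
    then have "ennreal c2 \<le> ennreal (\<Sum>i<m. b i)" by (rule ennreal_leI)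
    also have "\<dots> = (\<Sum>i<m. Lp_norm p \<Omega> (h l (J + int i)))" using b0 by (simp add: Lp sum_ennreal)
    finally show "\<exists>l\<in>I. ennreal c2 \<le> (\<Sum>i<m. Lp_norm p \<Omega> (h l (J + int i)))" using l(1) by blast
  qed
qed

section \<open>Counting separated scales\<close>

text \<open>A number in \<open>[0, 1]\<close> is at most its \<open>q\<close>-th power; this is
  applied to the shares \<open>a / (a + b)\<close> and \<open>b / (a + b)\<close>, which add up to
  1.\<close>

lemma powr_add_le_add_powr:
  fixes a b q :: real
  assumes "0 \<le> a" "0 \<le> b" "0 < q" "q \<le> 1"
  shows "(a + b) powr q \<le> a powr q + b powr q"
proof (cases "a + b = 0")
  case True
  then show ?thesis using assms by simp
next
  case False
  then have ab: "a + b > 0" using assms by simp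
  have *: "(a + b) powr q * (c / (a + b)) \<le> c powr q" if "0 \<le> c" "c \<le> a + b" for c
  proof -
    have "c / (a + b) \<le> (c / (a + b)) powr q"
      using that ab assms powr_mono'[of q 1 "c / (a + b)"] by simp
    then have "(a + b) powr q * (c / (a + b)) \<le> (a + b) powr q * (c / (a + b)) powr q"
      by (intro mult_left_mono) auto
    also have "\<dots> = c powr q" using that ab by (simp add: powr_divide)
    finally show ?thesis .
  qed
  have "(a + b) powr q = (a + b) powr q * (a / (a + b)) + (a + b) powr q * (b / (a + b))"
    using ab by (simp add: distrib_left[symmetric] add_divide_distrib[symmetric])
  also have "\<dots> \<le> a powr q + b powr q" using assms by (intro add_mono *) auto
  finally show ?thesis .
qed

lemma ennreal_powr_sum_le:
  assumes "0 < q" "q \<le> 1"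
  shows "ennreal_powr (\<Sum>i\<in>A. f i) q \<le> (\<Sum>i\<in>A. ennreal_powr (f i) q)"
proof (induction A rule: infinite_finite_induct)
  case (insert x F)
  have "ennreal_powr (a + b) q \<le> ennreal_powr a q + ennreal_powr b q" for a b
    using assms powr_add_le_add_powr
    by (cases a; cases b) (auto simp: ennreal_plus[symmetric] simp del: ennreal_plus intro!: ennreal_leI)
  then have "ennreal_powr (f x + sum f F) q \<le> ennreal_powr (f x) q + ennreal_powr (sum f F) q" .
  also have "\<dots> \<le> ennreal_powr (f x) q + (\<Sum>i\<in>F. ennreal_powr (f i) q)"
    by (intro add_left_mono insert)
  finally show ?case using insert by simp
qed auto

text \<open>The \<open>i\<close>-th window of scales is \<open>{J i..<J i + m}\<close>.\<close>

lemma disjoint_windows: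
  fixes J :: "nat \<Rightarrow> int" and d :: "nat \<Rightarrow> real"
  assumes J: "\<And>i. i < N \<Longrightarrow> 32 * d i \<le> 2 powi (- J i)" "\<And>i. i < N \<Longrightarrow> 2 powi (- J i) < 64 * d i"
    and d: "\<And>i j. i < j \<Longrightarrow> j < N \<Longrightarrow> 2 ^ (m + 1) * d i \<le> d j"
  shows "inj_on (\<lambda>(i, j). J i + int j) ({..<N} \<times> {..<m})"
proof -
  \<comment> \<open>\<open>2 powi (- J i)\<close> is within a factor 2 of \<open>32 * d i\<close>,
    so a ratio of at least \<open>2 ^ (m + 1)\<close> between distances separates the indices by
    more than \<open>m\<close>. Larger distances have smaller indices.\<close>
  have gap: "J j + int m < J i" if "i < j" "j < N" for i j
  proof -
    have "(2::real) powi (- J i + int m) = 2 powi (- J i) * 2 ^ m"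
      by (subst power_int_add) simp_all
    also have "\<dots> < 64 * d i * 2 ^ m" using J(2)[of i] that by simp
    also have "\<dots> = 32 * (2 ^ (m + 1) * d i)" by simp
    also have "\<dots> \<le> 32 * d j" using d[OF that] by (intro mult_left_mono) auto
    also have "\<dots> \<le> 2 powi (- J j)" using J(1) that by simp
    finally have "(2::real) powi (- J i + int m) < 2 powi (- J j)" .
    then show ?thesis
      using power_int_increasing[of "- J j" "- J i + int m" "2::real"] by force
  qed
  show ?thesis
  proof (rule inj_onI, clarsimp)
    fix i k i' k' assume A: "i < N" "k < m" "i' < N" "k' < m" "J i + int k = J i' + int k'"
    then have "i = i'" using gap[of i i'] gap[of i' i] by (cases i i' rule: linorder_cases) auto
    then show "i = i' \<and> k = k'" using A by simp
  qed
qed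

text \<open>The order of the constants matters: \<open>c2\<close> does not depend on
  \<open>N\<close>, so \<open>N\<close> is chosen against it first, and then \<open>M\<close>,
  \<open>\<Lambda>\<close>, the window length \<open>m\<close> and the separation factor
  \<open>Q\<close>. None of them depends on the points, so \<open>Q ^ N\<close> can serve as
  \<open>K\<close>.\<close>

lemma inverse_round:
  fixes \<phi> \<psi> :: "'a::euclidean_space \<Rightarrow> 'a"
  assumes dim: "DIM('a) \<ge> 2" and hom: "homeomorphism UNIV UNIV \<phi> \<psi>"
    and s: "0 < s" "s < 1" and p: "p = real DIM('a) / s" and q: "0 < q" "q \<le> 1"
    and bdd: "composition_uniformly_bounded s p q \<phi>"
  obtains K where "\<And>x y u v. dist x y = dist u v \<Longrightarrow> dist (\<psi> x) (\<psi> y) \<le> K * dist (\<psi> u) (\<psi> v)"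
proof -
  have cont: "continuous_on UNIV \<phi>" "continuous_on UNIV \<psi>" and inv: "\<And>x. \<phi> (\<psi> x) = x" "\<And>x. \<psi> (\<phi> x) = x"
    using hom by (auto simp: homeomorphism_def)
  have p1: "p > 1" "s * p = real DIM('a)" using s dim by (auto simp: p field_simps)
  then have p0: "p > 0" by simp
  obtain C where C: "C \<ge> 0" "\<And>\<Omega> f. bounded_domain \<Omega> \<Longrightarrow> continuous_on \<Omega> f \<Longrightarrow> f \<in> besov_space s p q \<Omega> \<Longrightarrow>
      besov_norm s p q (\<phi> -` \<Omega>) (f \<circ> \<phi>) \<le> ennreal C * besov_norm s p q \<Omega> f"
    using bdd unfolding composition_uniformly_bounded_def by blast
  obtain C3 where C3: "C3 \<ge> 0" "\<And>r X l \<Omega> (N::nat). \<lbrakk>r > 0; l \<in> wave_index; finite X; X \<noteq> {}; card X \<le> N; \<Omega> \<in> sets lebesgue\<rbrakk>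
      \<Longrightarrow> besov_norm s p q \<Omega> (wave r (X::'a set) l) \<le> ennreal (C3 * real N powr (1/p))"
    using besov_norm_wave_le[OF s p0 p1(2) q(1)] by metis
  let ?I = "wave_index :: ('a \<times> (real \<Rightarrow> real)) set"
  have I: "finite ?I" "?I \<noteq> {}" by auto
  \<comment> \<open>The addend 1 makes the bound on the infimum strict, so some gradient stays below
    it.\<close>
  define C4 where "C4 = C * C3 + 1"
  have C4: "C4 > 0" using C C3 by (simp add: C4_def add_nonneg_pos)
  define c0 where "c0 = 1 / (80 * real DIM('a))"
  have c0: "c0 > 0" by (simp add: c0_def)
  define c2 where "c2 = c0 / (16 * (3 * 16 ^ DIM('a) / unit_ball_vol (real DIM('a))) powr (1/p))"
  have c2: "c2 > 0" using c0 by (simp add: c2_def less_imp_neq[OF unit_ball_vol_pos, symmetric])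
  \<comment> \<open>The left side grows like \<open>N\<close> to the power \<open>q/p\<close>, and
    \<open>q/p < 1\<close>.\<close>
  have "\<exists>N::nat. N \<ge> 1 \<and> real (card ?I) * (C4 * real N powr (1/p)) powr q < real N * c2 powr q"
  proof -
    have "((\<lambda>x::real. x powr (q/p - 1)) \<longlongrightarrow> 0) at_top"
      using q p1 by (intro tendsto_neg_powr filterlim_ident) (simp add: field_simps)
    then have "((\<lambda>N. real N powr (q/p - 1)) \<longlonglongrightarrow> 0)"
      by (rule filterlim_compose) (rule filterlim_real_sequentially)
    then have "(\<lambda>N. real (card ?I) * C4 powr q * real N powr (q/p - 1)) \<longlonglongrightarrow> real (card ?I) * C4 powr q * 0"
      by (intro tendsto_intros)
    then have "\<forall>\<^sub>F N in sequentially. real (card ?I) * C4 powr q * real N powr (q/p - 1) < c2 powr q"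
      by (rule order_tendstoD(2)) (use c2 in simp)
    then have "\<forall>\<^sub>F N in sequentially. N \<ge> 1 \<and> real (card ?I) * C4 powr q * real N powr (q/p - 1) < c2 powr q"
      using eventually_ge_at_top[of 1] by eventually_elim auto
    then obtain N where N: "N \<ge> 1" "real (card ?I) * C4 powr q * real N powr (q/p - 1) < c2 powr q"
      using eventually_happens'[OF sequentially_bot] by blast
    then have "real N * (real (card ?I) * C4 powr q * real N powr (q/p - 1)) < real N * c2 powr q" by simp
    moreover have N_powr: "real N powr (q/p) = real N * real N powr (q/p - 1)"
      using N by (simp add: powr_diff)
    have "(C4 * real N powr (1/p)) powr q = C4 powr q * real N powr (q/p)"
      using C4 by (simp add: powr_mult powr_powr)
    then have "real (card ?I) * (C4 * real N powr (1/p)) powr q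
        = real N * (real (card ?I) * C4 powr q * real N powr (q/p - 1))"
      unfolding N_powr by (simp only: mult_ac)
    ultimately show ?thesis using N(1) by (intro exI[of _ N]) simp
  qed
  then obtain N :: nat where N: "N \<ge> 1" "real (card ?I) * (C4 * real N powr (1/p)) powr q < real N * c2 powr q" by blast
  define M where "M = C4 * real N powr (1/p)"
  have M: "M > 0" using C4 N by (simp add: M_def)
  \<comment> \<open>A single term of the sum of \<open>q\<close>-th powers bounds each
    \<open>Lp_norm\<close> by \<open>M\<close>, hence each \<open>p\<close>-integral by
    \<open>M powr p\<close>.\<close>
  define \<Lambda> where "\<Lambda> = M powr p"
  have \<Lambda>: "\<Lambda> > 0" using M by (simp add: \<Lambda>_def)
  obtain m :: nat where window: "\<And>x y r d \<Omega> G h J. \<lbrakk>x \<noteq> y; r = dist x y; d = dist (\<psi> x) (\<psi> y); open \<Omega>; ball (\<psi> x) (256 * d) \<subseteq> \<Omega>;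
      32 * d \<le> 2 powi (- J); 2 powi (- J) < 64 * d;
      \<And>l. l \<in> ?I \<Longrightarrow> continuous_on \<Omega> (G l);
      \<And>l. l \<in> ?I \<Longrightarrow> hajlasz_gradient s \<Omega> (G l) (h l);
      \<And>l k. l \<in> ?I \<Longrightarrow> (\<integral>\<^sup>+z. ennreal_powr (h l k z) p \<partial>lebesgue_on \<Omega>) \<le> ennreal \<Lambda>;
      \<And>A B. dist (\<phi> A) (\<phi> B) = r / 20 \<Longrightarrow> \<phi> A \<in> cball x r \<Longrightarrow> \<exists>l\<in>?I. c0 \<le> \<bar>G l A - G l B\<bar>\<rbrakk>
    \<Longrightarrow> \<exists>l\<in>?I. ennreal c2 \<le> (\<Sum>i<m. Lp_norm p \<Omega> (h l (J + int i)))"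
    using oscillation_in_window[OF dim hom p0 p1(2) s(1) I \<Lambda> c0] unfolding c2_def[symmetric] by blast
  define Q where "Q = (2::real) ^ (m + 1)"
  have Q: "Q \<ge> 1" unfolding Q_def by (rule one_le_power) simp
  have main: "dist (\<psi> x) (\<psi> y) \<le> Q ^ N * dist (\<psi> u) (\<psi> v)" if eqd: "dist x y = dist u v" for x y u v
  proof (rule ccontr)
    assume "\<not> ?thesis"
    then have big: "Q ^ N * dist (\<psi> u) (\<psi> v) < dist (\<psi> x) (\<psi> y)" by simp
    define r where "r = dist u v"
    have r: "r > 0"
    proof (rule ccontr)
      assume "\<not> r > 0"
      then have "x = y" using eqd by (simp add: r_def)
      moreover have "0 \<le> Q ^ N * dist (\<psi> u) (\<psi> v)" using Q by simp
      ultimately show False using big by simp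
    qed
    define lo where "lo = dist (\<psi> u) (\<psi> v)"
    have lo: "lo > 0" using r inv(1) unfolding lo_def r_def by (metis zero_less_dist_iff)
    \<comment> \<open>The negated claim leaves room for \<open>N\<close> distances in geometric
      progression between \<open>lo\<close> and \<open>dist (\<psi> x) (\<psi> y)\<close>.\<close>
    define d where "d i = lo * Q ^ i" for i :: nat
    have d: "d i > 0" for i using lo Q by (simp add: d_def)
    have "\<exists>a b. dist a b = r \<and> dist (\<psi> a) (\<psi> b) = d i" if i: "i < N" for i
    proof -
      \<comment> \<open>Pairs at distance \<open>r\<close> are parametrised by a point and a
        displacement. This set is connected, so every intermediate distance of images
        occurs.\<close>
      have "connected ((UNIV :: 'a set) \<times> sphere (0::'a) r)" using dim by (intro connected_Times connected_sphere connected_UNIV) simp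
      moreover have "continuous_on ((UNIV :: 'a set) \<times> sphere (0::'a) r) (\<lambda>w. dist (\<psi> (fst w)) (\<psi> (fst w + snd w)))"
        by (intro continuous_intros continuous_on_compose2[OF cont(2)]) auto
      moreover have "(u, v - u) \<in> (UNIV :: 'a set) \<times> sphere 0 r" "(x, y - x) \<in> (UNIV :: 'a set) \<times> sphere 0 r"
        using eqd by (auto simp: r_def dist_norm norm_minus_commute)
      moreover have "lo \<le> d i" using lo Q by (simp add: d_def)
      moreover have "d i \<le> dist (\<psi> x) (\<psi> y)"
      proof -
        have "d i \<le> lo * Q ^ N" unfolding d_def using lo Q i by (intro mult_left_mono power_increasing) auto
        then show ?thesis using big by (simp add: lo_def mult.commute)
      qed
      ultimately obtain w where w: "w \<in> (UNIV :: 'a set) \<times> sphere (0::'a) r" "dist (\<psi> (fst w)) (\<psi> (fst w + snd w)) = d i"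
        using connected_attains_value[of "(UNIV :: 'a set) \<times> sphere (0::'a) r" "\<lambda>w. dist (\<psi> (fst w)) (\<psi> (fst w + snd w))" "(u, v - u)" "(x, y - x)" "d i"]
        by (auto simp: lo_def)
      then show ?thesis by (intro exI[of _ "fst w"] exI[of _ "fst w + snd w"]) (auto simp: dist_norm)
    qed
    then obtain a b where ab: "\<And>i. i < N \<Longrightarrow> dist (a i) (b i) = r" "\<And>i. i < N \<Longrightarrow> dist (\<psi> (a i)) (\<psi> (b i)) = d i"
      by metis
    define X where "X = a ` {..<N}"
    have X: "finite X" "X \<noteq> {}" "card X \<le> N"
      using N(1) card_image_le[of "{..<N}" a] by (auto simp: X_def lessThan_empty_iff)
    have "bounded (\<Union>i<N. ball (\<psi> (a i)) (256 * d i))" by (intro bounded_UN) auto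
    then obtain R where R: "R > 0" "(\<Union>i<N. ball (\<psi> (a i)) (256 * d i)) \<subseteq> ball 0 R"
      using bounded_subset_ballD by blast
    \<comment> \<open>The ball is taken in the domain of \<open>\<phi>\<close>, where it contains
      the neighbourhoods needed for all \<open>N\<close> windows; \<open>\<Omega>\<close> is its
      image.\<close>
    define D where "D = ball (0::'a) R"
    define \<Omega> where "\<Omega> = \<phi> ` D"
    have D: "open D" "\<phi> -` \<Omega> = D"
      using inv(2) by (auto simp: D_def \<Omega>_def) (metis mem_ball_0)
    have "open \<Omega>" unfolding \<Omega>_def using homeomorphism_imp_open_map[OF hom] D(1) by simp
    moreover have "connected \<Omega>" unfolding \<Omega>_def D_def
      by (intro connected_continuous_image continuous_on_subset[OF cont(1)]) auto
    moreover have "bounded \<Omega>"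
    proof -
      have "compact (\<phi> ` cball 0 R)" by (intro compact_continuous_image continuous_on_subset[OF cont(1)]) auto
      then show ?thesis unfolding \<Omega>_def D_def by (meson ball_subset_cball bounded_subset compact_imp_bounded image_mono)
    qed
    ultimately have dom: "bounded_domain \<Omega>" and o\<Omega>: "open \<Omega>" using R(1) by (auto simp: bounded_domain_def \<Omega>_def D_def)
    define G where "G l = wave r X l \<circ> \<phi>" for l
    have "\<exists>g. hajlasz_gradient s D (G l) g \<and> (\<Sum>\<^sub>\<infinity>k::int. ennreal_powr (Lp_norm p D (g k)) q) \<le> ennreal (M powr q)"
      if l: "l \<in> ?I" for l
    proof -
      have nw: "besov_norm s p q \<Omega> (wave r X l) \<le> ennreal (C3 * real N powr (1/p))"
        using o\<Omega> by (intro C3(2) r l X) auto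
      have "wave r X l \<in> borel_measurable (lebesgue_on \<Omega>)"
        using o\<Omega> by (intro continuous_imp_measurable_on_sets_lebesgue continuous_on_wave l) auto
      then have "wave r X l \<in> besov_space s p q \<Omega>"
        using nw unfolding besov_space_def by (auto intro: le_less_trans)
      then have "besov_norm s p q D (G l) \<le> ennreal C * besov_norm s p q \<Omega> (wave r X l)"
        using C(2)[OF dom continuous_on_wave[OF l]] by (simp add: D G_def)
      also have "\<dots> \<le> ennreal C * ennreal (C3 * real N powr (1/p))" by (intro mult_left_mono nw) auto
      also have "\<dots> = ennreal (C * C3 * real N powr (1/p))" using C(1) C3(1) by (simp add: ennreal_mult[symmetric] mult.assoc)
      also have "\<dots> < ennreal M"
        using M N(1) by (intro ennreal_lessI) (auto simp: M_def C4_def algebra_simps)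
      finally have "besov_norm s p q D (G l) < ennreal M" .
      then obtain g where g: "hajlasz_gradient s D (G l) g"
        "ennreal_powr (\<Sum>\<^sub>\<infinity>k::int. ennreal_powr (Lp_norm p D (g k)) q) (1 / q) < ennreal M"
        unfolding besov_norm_def INF_less_iff by auto
      then have "ennreal_powr (\<Sum>\<^sub>\<infinity>k::int. ennreal_powr (Lp_norm p D (g k)) q) (1 / q) \<le> ennreal M" by simp
      then show ?thesis using g(1) q(1) M by (subst (asm) ennreal_powr_le_iff) auto
    qed
    then obtain h where h: "\<And>l. l \<in> ?I \<Longrightarrow> hajlasz_gradient s D (G l) (h l)"
      "\<And>l. l \<in> ?I \<Longrightarrow> (\<Sum>\<^sub>\<infinity>k::int. ennreal_powr (Lp_norm p D (h l k)) q) \<le> ennreal (M powr q)"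
      by metis
    have hsum: "(\<Sum>k\<in>F. ennreal_powr (Lp_norm p D (h l k)) q) \<le> ennreal (M powr q)" if "l \<in> ?I" "finite F" for l F
    proof -
      have "(\<Sum>k\<in>F. ennreal_powr (Lp_norm p D (h l k)) q) \<le> (SUP F\<in>{F. finite F \<and> F \<subseteq> UNIV}. \<Sum>k\<in>F. ennreal_powr (Lp_norm p D (h l k)) q)"
        using that(2) by (intro SUP_upper) auto
      also have "\<dots> = (\<Sum>\<^sub>\<infinity>k::int. ennreal_powr (Lp_norm p D (h l k)) q)"
        by (intro nonneg_infsum_complete[symmetric]) simp
      finally show ?thesis using h(2)[OF that(1)] by simp
    qed
    have h\<Lambda>: "(\<integral>\<^sup>+z. ennreal_powr (h l k z) p \<partial>lebesgue_on D) \<le> ennreal \<Lambda>" if "l \<in> ?I" for l k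
    proof -
      have "ennreal_powr (Lp_norm p D (h l k)) q \<le> ennreal (M powr q)" using hsum[OF that, of "{k}"] by simp
      then have "Lp_norm p D (h l k) \<le> ennreal M" using q(1) M by (simp add: ennreal_powr_le_iff powr_powr)
      then show ?thesis unfolding Lp_norm_def using p0 M by (simp add: ennreal_powr_le_iff \<Lambda>_def)
    qed
    have "\<exists>J::int. 32 * d i \<le> 2 powi (- J) \<and> 2 powi (- J) < 64 * d i" for i
      using exists_dyadic_scale[of "32 * d i"] d[of i] by (auto simp: mult.assoc)
    then obtain J :: "nat \<Rightarrow> int" where J: "\<And>i. 32 * d i \<le> 2 powi (- J i)" "\<And>i. 2 powi (- J i) < 64 * d i" by metis
    have low: "\<exists>l\<in>?I. ennreal c2 \<le> (\<Sum>j<m. Lp_norm p D (h l (J i + int j)))" if i: "i < N" for i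
    proof (rule window[of "a i" "b i" r "d i" D "J i" G h])
      show "a i \<noteq> b i" "r = dist (a i) (b i)" "d i = dist (\<psi> (a i)) (\<psi> (b i))" using ab[OF i] r by auto
      show "ball (\<psi> (a i)) (256 * d i) \<subseteq> D" using R(2) i by (auto simp: D_def)
      show "continuous_on D (G l)" if "l \<in> ?I" for l
        unfolding G_def by (intro continuous_on_compose continuous_on_subset[OF cont(1)] continuous_on_wave that) auto
      show "\<exists>l\<in>?I. c0 \<le> \<bar>G l A - G l B\<bar>" if "dist (\<phi> A) (\<phi> B) = r / 20" "\<phi> A \<in> cball (a i) r" for A B
        using wave_oscillation[OF r _ that(2,1), of X] i by (auto simp: G_def c0_def X_def)
    qed (use D J h h\<Lambda> in auto)
    \<comment> \<open>The detecting index may change with \<open>i\<close>; summing over all indices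
      costs only the factor \<open>card ?I\<close>.\<close>
    have lowq: "ennreal (c2 powr q) \<le> (\<Sum>l\<in>?I. \<Sum>j<m. ennreal_powr (Lp_norm p D (h l (J i + int j))) q)" if i: "i < N" for i
    proof -
      obtain l where l: "l \<in> ?I" "ennreal c2 \<le> (\<Sum>j<m. Lp_norm p D (h l (J i + int j)))" using low[OF i] by blast
      have "ennreal (c2 powr q) = ennreal_powr (ennreal c2) q" using c2 by simp
      also have "\<dots> \<le> ennreal_powr (\<Sum>j<m. Lp_norm p D (h l (J i + int j))) q" by (intro ennreal_powr_mono l q)
      also have "\<dots> \<le> (\<Sum>j<m. ennreal_powr (Lp_norm p D (h l (J i + int j))) q)" by (intro ennreal_powr_sum_le q)
      also have "\<dots> \<le> (\<Sum>l\<in>?I. \<Sum>j<m. ennreal_powr (Lp_norm p D (h l (J i + int j))) q)"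
        using I(1) l(1) by (intro member_le_sum) auto
      finally show ?thesis .
    qed
    have inj: "inj_on (\<lambda>(i, j). J i + int j) ({..<N} \<times> {..<m})"
    proof (rule disjoint_windows)
      fix i j :: nat assume "i < j"
      have "2 ^ (m + 1) * d i = lo * Q ^ (Suc i)" by (simp add: d_def Q_def)
      also have "\<dots> \<le> lo * Q ^ j" using \<open>i < j\<close> lo Q by (intro mult_left_mono power_increasing) auto
      finally show "2 ^ (m + 1) * d i \<le> d j" by (simp add: d_def)
    qed (use J in auto)
    \<comment> \<open>The sum over all windows is counted in two ways: from below by one
      contribution per window, from above by the full sum for each index, since disjoint windows use
      each scale at most once.\<close>
    have "ennreal (real N * c2 powr q) = (\<Sum>i<N. ennreal (c2 powr q))"
      by (simp add: ennreal_mult ennreal_of_nat_eq_real_of_nat)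
    also have "\<dots> \<le> (\<Sum>i<N. \<Sum>l\<in>?I. \<Sum>j<m. ennreal_powr (Lp_norm p D (h l (J i + int j))) q)"
      by (intro sum_mono lowq) auto
    also have "\<dots> = (\<Sum>l\<in>?I. \<Sum>i<N. \<Sum>j<m. ennreal_powr (Lp_norm p D (h l (J i + int j))) q)"
      by (rule sum.swap)
    also have "\<dots> = (\<Sum>l\<in>?I. \<Sum>k\<in>(\<lambda>(i, j). J i + int j) ` ({..<N} \<times> {..<m}). ennreal_powr (Lp_norm p D (h l k)) q)"
      by (intro sum.cong refl, subst sum.reindex[OF inj])
        (simp add: sum.cartesian_product case_prod_unfold comp_def)
    also have "\<dots> \<le> (\<Sum>l\<in>?I. ennreal (M powr q))" by (intro sum_mono hsum) auto
    also have "\<dots> = ennreal (real (card ?I) * M powr q)"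
      by (simp add: ennreal_mult ennreal_of_nat_eq_real_of_nat)
    finally have "real N * c2 powr q \<le> real (card ?I) * M powr q" by (subst (asm) ennreal_le_iff) auto
    then show False using N(2) by (simp add: M_def)
  qed
  then show thesis by (rule that)
qed

theorem theorem2p9:
  fixes \<phi> :: "real ^ 'n \<Rightarrow> real ^ 'n" and s q :: real
  assumes "CARD('n) \<ge> 2"
    and "0 < s" and "s < 1"
    and "0 < q" and "q \<le> 1"
    and "\<exists>\<psi>. homeomorphism UNIV UNIV \<phi> \<psi>"
    and "composition_uniformly_bounded s (real CARD('n) / s) q \<phi>"
  shows "bi_lipschitz \<phi>"
proof -
  from assms(6) obtain \<psi> where hom: "homeomorphism UNIV UNIV \<phi> \<psi>" by blast
  have dim: "DIM(real ^ 'n) = CARD('n)" by simp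
  obtain K where "\<And>x y u v. dist x y = dist u v \<Longrightarrow> dist (\<psi> x) (\<psi> y) \<le> K * dist (\<psi> u) (\<psi> v)"
    using inverse_round[OF _ hom assms(2,3) _ assms(4,5,7)] assms(1) unfolding dim by blast
  then show ?thesis by (rule bi_lipschitz_if_inverse_round[OF hom])
qed

end
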